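(* There is an $\mathsf{MA}$ communication protocol for $\textsf{DISJ}_n$ and for $\textsf{IP}_n$ with communication complexity $O\left(\sqrt{n\log n\log\log n}\right)$.
   Context: $\textsf{DISJ}_n$: Alice holds $X\in\{0,1\}^n$, Bob holds $Y\in\{0,1\}^n$, and they want to determine whether $X\cdot Y=0$. $\textsf{IP}_n$: same inputs, and they want to compute $X\cdot Y$. In an $\mathsf{MA}$ protocol, Merlin (who sees both inputs) sends Alice an advice string; Alice and Bob then jointly toss public random coins, Bob sends Alice a message, and Alice accepts or rejects. For a Boolean function, if the answer is yes there is an advice making Alice accept with high probability (e.g. $\ge 2/3$), while if the answer is no every advice leads to acceptance with low probability (e.g. $\le1/3$). For the non-Boolean $\textsf{IP}_n$, Merlin's advice includes a claimed value of $X\cdot Y$ together with a proof; for the correct value some proof is accepted with high probability, and for any wrong claimed value every proof is rejected with high probability. The communication complexity is the advice length plus the number of bits communicated between Alice and Bob. *)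

theory Defs
  imports "HOL-Probability.Probability_Mass_Function" "HOL-Library.Landau_Symbols"
begin

text \<open>
  In \<open>alice X w r m\<close> and \<open>bob Y r\<close>, \<open>w\<close> is Merlin's advice, \<open>r\<close> the public coins and \<open>m\<close> Bob's
  message. Merlin talks to Alice only, so Bob's message does not depend on \<open>w\<close>.
\<close>

record ma_protocol =
  advice_len :: nat
  coin_len :: nat
  message_len :: nat
  bob :: "bool list \<Rightarrow> bool list \<Rightarrow> bool list"
  alice :: "bool list \<Rightarrow> bool list \<Rightarrow> bool list \<Rightarrow> bool list \<Rightarrow> bool"

definition bitstrings :: "nat \<Rightarrow> bool list set" where
  "bitstrings n = {w. length w = n}"

definition ma_wf :: "nat \<Rightarrow> ma_protocol \<Rightarrow> bool" where
  "ma_wf n P \<longleftrightarrow>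
     (\<forall>Y\<in>bitstrings n. \<forall>r\<in>bitstrings (coin_len P). bob P Y r \<in> bitstrings (message_len P))"

text \<open>Public coins are free: only the advice and Bob's message are charged.\<close>

definition ma_cost :: "ma_protocol \<Rightarrow> nat" where
  "ma_cost P = advice_len P + message_len P"

definition accept_prob :: "ma_protocol \<Rightarrow> bool list \<Rightarrow> bool list \<Rightarrow> bool list \<Rightarrow> real" where
  "accept_prob P X Y w =
     measure_pmf.prob (pmf_of_set (bitstrings (coin_len P))) {r. alice P X w r (bob P Y r)}"

definition ma_decides :: "nat \<Rightarrow> ma_protocol \<Rightarrow> (bool list \<Rightarrow> bool list \<Rightarrow> bool) \<Rightarrow> bool" where
  "ma_decides n P f \<longleftrightarrow> ma_wf n P \<and>
     (\<forall>X\<in>bitstrings n. \<forall>Y\<in>bitstrings n.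
        (f X Y \<longrightarrow> (\<exists>w\<in>bitstrings (advice_len P). accept_prob P X Y w \<ge> 2/3)) \<and>
        (\<not> f X Y \<longrightarrow> (\<forall>w\<in>bitstrings (advice_len P). accept_prob P X Y w \<le> 1/3)))"

text \<open>
  For a function with values in \<open>nat\<close>, the first \<open>l\<close> bits of the advice are the claimed value
  in binary (least significant bit first) and the remaining bits are the proof. The bits of the
  claim are thus part of the advice length.
\<close>

definition claimed_value :: "nat \<Rightarrow> bool list \<Rightarrow> nat" where
  "claimed_value l w = horner_sum of_bool 2 (take l w)"

definition ma_computes :: "nat \<Rightarrow> ma_protocol \<Rightarrow> (bool list \<Rightarrow> bool list \<Rightarrow> nat) \<Rightarrow> bool" where
  "ma_computes n P f \<longleftrightarrow> ma_wf n P \<and>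
     (\<exists>l\<le>advice_len P. \<forall>X\<in>bitstrings n. \<forall>Y\<in>bitstrings n.
        (\<exists>w\<in>bitstrings (advice_len P).
           claimed_value l w = f X Y \<and> accept_prob P X Y w \<ge> 2/3) \<and>
        (\<forall>w\<in>bitstrings (advice_len P).
           claimed_value l w \<noteq> f X Y \<longrightarrow> accept_prob P X Y w \<le> 1/3))"

definition IP :: "nat \<Rightarrow> bool list \<Rightarrow> bool list \<Rightarrow> nat" where
  "IP n X Y = (\<Sum>i<n. of_bool (X ! i) * of_bool (Y ! i))"

definition DISJ :: "nat \<Rightarrow> bool list \<Rightarrow> bool list \<Rightarrow> bool" where
  "DISJ n X Y \<longleftrightarrow> IP n X Y = 0"

end

theory Submission
  imports Defs "HOL-Number_Theory.Number_Theory"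
begin

text \<open>
  Let \<open>a = log n\<close>, \<open>b = log log n\<close> and \<open>t \<approx> \<surd>(n b / a)\<close>, and split the inputs into \<open>J = n / t\<close> blocks of
  \<open>t\<close> bits. For a prime \<open>p\<close> of polylogarithmic size, encode every block by a function on the points of the
  Hermitian tower \<open>x\<^sub>i\<^sub>+\<^sub>1\<^sup>p + x\<^sub>i\<^sub>+\<^sub>1 = x\<^sub>i\<^sup>p\<^sup>+\<^sup>1\<close> over the field with \<open>p\<^sup>2\<close> elements, whose values at \<open>t\<close> fixed
  points are the bits of the block. If \<open>f\<^sub>j\<close> and \<open>g\<^sub>j\<close> encode the blocks of Alice and Bob, then
  \<open>R = (\<Sum>j. f\<^sub>j g\<^sub>j)\<close> lies in a space of dimension \<open>O(t)\<close>, its values at the fixed points add up to the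
  inner product modulo \<open>p\<close>, and two different functions of this space agree at few points only. So
  Merlin sends \<open>R\<close>, and it suffices to compare it with the true sum at a random point, for which
  Bob sends the \<open>J\<close> values \<open>g\<^sub>j\<close> of \<open>O(log p) = O(b)\<close> bits each.

  To get the integer value, Merlin does this for \<open>O(a / b)\<close> primes, at a cost of \<open>O(b t)\<close> bits each, and
  Alice and Bob check a random one of them: a wrong value below \<open>2n\<close> is right modulo \<open>a / b\<close> primes at most.
  The total is \<open>O(a t + b n / t) = O(\<surd>(n a b))\<close>. A protocol for \<open>IP\<close> decides \<open>DISJ\<close> once Alice
  insists on the claimed value \<open>0\<close>.

  The bound on the number of zeros rests on the single pole of the tower: monomials of equal pole order
  agree up to monomials of smaller order, so pole orders are additive under multiplication, and
  multiplication by a function with many zeros would embed a large space into a smaller one.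
\<close>

section \<open>Functions on the Hermitian tower\<close>

locale ideal_congruence =
  fixes I :: "'a::comm_ring_1 set"
  assumes zero_I: "0 \<in> I"
    and add_I: "x \<in> I \<Longrightarrow> y \<in> I \<Longrightarrow> x + y \<in> I"
    and mult_I: "x \<in> I \<Longrightarrow> a * x \<in> I"
begin

definition eqv :: "'a \<Rightarrow> 'a \<Rightarrow> bool" (infix "\<simeq>" 50)
  where "x \<simeq> y \<longleftrightarrow> x - y \<in> I"

lemma minus_I: "x \<in> I \<Longrightarrow> - x \<in> I"
  using mult_I[of x "-1"] by simp

lemma eqv_refl [simp, intro!]: "x \<simeq> x"
  by (simp add: eqv_def zero_I)

lemma eqv_sym: "x \<simeq> y \<Longrightarrow> y \<simeq> x"
  using minus_I[of "x - y"] by (simp add: eqv_def)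

lemma eqv_trans [trans]: "x \<simeq> y \<Longrightarrow> y \<simeq> z \<Longrightarrow> x \<simeq> z"
  using add_I[of "x - y" "y - z"] by (simp add: eqv_def)

lemma eqv_add: "x \<simeq> y \<Longrightarrow> u \<simeq> v \<Longrightarrow> x + u \<simeq> y + v"
  using add_I[of "x - y" "u - v"] by (simp add: eqv_def algebra_simps)

lemma eqv_minus: "x \<simeq> y \<Longrightarrow> - x \<simeq> - y"
  using minus_I[of "x - y"] by (simp add: eqv_def)

lemma eqv_diff: "x \<simeq> y \<Longrightarrow> u \<simeq> v \<Longrightarrow> x - u \<simeq> y - v"
  using eqv_add[OF _ eqv_minus] by simp

lemma eqv_mult: "x \<simeq> y \<Longrightarrow> u \<simeq> v \<Longrightarrow> x * u \<simeq> y * v"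
  using add_I[OF mult_I[of "x - y" u] mult_I[of "u - v" y]]
  by (simp add: eqv_def algebra_simps)

lemma eqv_power: "x \<simeq> y \<Longrightarrow> x ^ n \<simeq> y ^ n"
  by (induction n) (auto intro: eqv_mult)

lemma eqv_sum: "(\<And>i. i \<in> S \<Longrightarrow> f i \<simeq> g i) \<Longrightarrow> sum f S \<simeq> sum g S"
  by (induction S rule: infinite_finite_induct) (auto intro: eqv_add)

lemma eqv_diff_zero: "x \<simeq> y \<longleftrightarrow> x - y \<simeq> 0"
  by (simp add: eqv_def)

lemma eqv_mult_zero: "x \<simeq> 0 \<Longrightarrow> y * x \<simeq> 0"
  using mult_I by (simp add: eqv_def)

end

text \<open>
  The characteristic varies with \<open>n\<close>, so there is no type for the field with \<open>q\<^sup>2\<close> elements. It is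
  represented by a maximal ideal \<open>I\<close> of a ring type, with a system \<open>C\<close> of representatives.
\<close>

locale residue_field_sq = ideal_congruence I for I :: "'a::comm_ring_1 set" +
  fixes C :: "'a set" and q :: nat
  assumes inverse_I: "x \<notin> I \<Longrightarrow> \<exists>y. x * y - 1 \<in> I"
    and of_nat_I: "of_nat k \<in> I \<longleftrightarrow> q dvd k"
    and rep_ex: "\<exists>!c. c \<in> C \<and> x - c \<in> I"
    and card_C: "card C = q * q"
    and q_ge_2: "q \<ge> 2"
    and power_qq: "x ^ (q * q) - x \<in> I"
    and card_fibre: "card {y \<in> C. y ^ q + y - x ^ Suc q \<in> I} = q"
begin

lemma one_not_zero: "\<not> 1 \<simeq> 0"
  using of_nat_I[of 1] q_ge_2 by (simp add: eqv_def)

lemma inverse_ex: "\<not> x \<simeq> 0 \<Longrightarrow> \<exists>y. x * y \<simeq> 1"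
  using inverse_I by (simp add: eqv_def)

lemma mult_eqv_zero_iff: "x * y \<simeq> 0 \<longleftrightarrow> x \<simeq> 0 \<or> y \<simeq> 0"
proof
  assume xy: "x * y \<simeq> 0"
  show "x \<simeq> 0 \<or> y \<simeq> 0"
  proof (cases "x \<simeq> 0")
    case True then show ?thesis ..
  next
    case False
    then obtain z where z: "x * z \<simeq> 1" using inverse_ex by blast
    have "y \<simeq> (x * z) * y" using eqv_mult[OF eqv_sym[OF z] eqv_refl[of y]] by simp
    also have "\<dots> \<simeq> 0" using eqv_mult_zero[OF xy, of z] by (simp add: ac_simps)
    finally show ?thesis ..
  qed
qed (metis eqv_mult_zero mult.commute)

lemma finite_C: "finite C"
  using card_C q_ge_2 by (metis card.infinite mult_eq_0_iff not_numeral_le_zero)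

section \<open>Representatives of residue classes and points of the tower\<close>

definition rep :: "'a \<Rightarrow> 'a" where "rep x = (THE c. c \<in> C \<and> x \<simeq> c)"

lemma rep: "rep x \<in> C" "x \<simeq> rep x"
  using theI'[OF rep_ex[of x]] by (simp_all add: rep_def eqv_def)

lemma rep_unique: "c \<in> C \<Longrightarrow> x \<simeq> c \<Longrightarrow> rep x = c"
  using rep_ex[of x] rep[of x] by (auto simp: eqv_def)

lemma rep_C: "c \<in> C \<Longrightarrow> rep c = c"
  by (rule rep_unique) auto

lemma rep_eq_iff: "rep x = rep y \<longleftrightarrow> x \<simeq> y"
  by (metis eqv_sym eqv_trans rep rep_unique)

lemma C_eqv_imp_eq: "x \<in> C \<Longrightarrow> y \<in> C \<Longrightarrow> x \<simeq> y \<Longrightarrow> x = y"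
  by (metis rep_C rep_eq_iff)

definition fibre :: "'a list \<Rightarrow> 'a set"
  where "fibre c = {y \<in> C. y ^ q + y \<simeq> hd c ^ Suc q}"

text \<open>Points of the Hermitian tower; the most recently adjoined coordinate is the head of the list.\<close>

primrec pts :: "nat \<Rightarrow> 'a list set" where
  "pts 0 = (\<lambda>x. [x]) ` C"
| "pts (Suc L) = (\<lambda>(c, y). y # c) ` Sigma (pts L) fibre"

lemma card_fibre': "card (fibre c) = q"
  using card_fibre by (simp add: fibre_def eqv_def)

lemma finite_fibre: "finite (fibre c)"
  by (simp add: fibre_def finite_C)

lemma fibre_C: "fibre c \<subseteq> C"
  by (auto simp: fibre_def)

lemma finite_pts: "finite (pts L)"
  by (induction L) (auto simp: finite_C finite_fibre)

lemma card_pts: "card (pts L) = q ^ (L + 2)"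
proof (induction L)
  case 0
  have "inj_on (\<lambda>x. [x]) C" by (auto simp: inj_on_def)
  then show ?case by (simp add: card_image card_C power2_eq_square)
next
  case (Suc L)
  have "inj_on (\<lambda>(c, y). y # c) (Sigma (pts L) fibre)" by (auto simp: inj_on_def)
  then show ?case using Suc by (simp add: card_image finite_pts finite_fibre card_fibre')
qed

lemma length_pts: "c \<in> pts L \<Longrightarrow> length c = Suc L"
  by (induction L arbitrary: c) auto

lemma pts_SucE:
  assumes "c' \<in> pts (Suc L)"
  obtains y c where "c' = y # c" "c \<in> pts L" "y \<in> fibre c"
  using assms by auto

section \<open>Monomials and the filtration by pole order\<close>

fun mon :: "nat list \<Rightarrow> 'a list \<Rightarrow> 'a" where
  "mon (b # e) (y # c) = y ^ b * mon e c"
| "mon _ _ = 1"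

primrec wt :: "nat list \<Rightarrow> nat" where
  "wt [] = 0"
| "wt (b # e) = q * wt e + b * (q + 1) ^ length e"

lemma mon_add:
  "length e = length e' \<Longrightarrow> mon (map2 (+) e e') c = mon e c * mon e' c"
  by (induction e e' arbitrary: c rule: list_induct2)
     (case_tac c; simp add: power_add algebra_simps)+

lemma wt_add:
  "length e = length e' \<Longrightarrow> wt (map2 (+) e e') = wt e + wt e'"
  by (induction e e' rule: list_induct2) (simp_all add: algebra_simps)

text \<open>\<open>wt e\<close> is the pole order of the monomial \<open>mon e\<close> at the point at infinity, so that \<open>W L s\<close>
  consists of the functions with pole order less than \<open>s\<close>.\<close>

inductive_set W :: "nat \<Rightarrow> nat \<Rightarrow> ('a list \<Rightarrow> 'a) set" for L s where
  W_zero: "(\<And>c. c \<in> pts L \<Longrightarrow> f c \<simeq> 0) \<Longrightarrow> f \<in> W L s"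
| W_step: "f \<in> W L s \<Longrightarrow> length e = Suc L \<Longrightarrow> wt e < s \<Longrightarrow>
    (\<And>c. c \<in> pts L \<Longrightarrow> g c \<simeq> f c + a * mon e c) \<Longrightarrow> g \<in> W L s"

lemma W_cong:
  assumes "f \<in> W L s" "\<And>c. c \<in> pts L \<Longrightarrow> g c \<simeq> f c"
  shows "g \<in> W L s"
  using assms
proof (cases rule: W.cases)
  case W_zero
  then show ?thesis using assms(2) by (blast intro: W.W_zero eqv_trans)
next
  case (W_step f' e a)
  then show ?thesis using assms(2) by (blast intro: W.W_step eqv_trans)
qed

lemma W_add:
  assumes "f \<in> W L s" "g \<in> W L s"
  shows "(\<lambda>c. f c + g c) \<in> W L s"
  using assms(1)
proof induction
  case (W_zero f)
  show ?case
    by (rule W_cong[OF assms(2)]) (use W_zero eqv_add[OF _ eqv_refl] in fastforce)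
next
  case (W_step f e h a)
  show ?case
  proof (rule W.W_step[OF W_step.IH W_step.hyps(2,3)])
    fix c assume "c \<in> pts L"
    from eqv_add[OF W_step.hyps(4)[OF this] eqv_refl[of "g c"]]
    show "h c + g c \<simeq> f c + g c + a * mon e c" by (simp add: algebra_simps)
  qed
qed

lemma W_scale:
  assumes "f \<in> W L s"
  shows "(\<lambda>c. b * f c) \<in> W L s"
  using assms
proof induction
  case (W_zero f)
  then show ?case by (intro W.W_zero) (simp add: eqv_mult_zero)
next
  case (W_step f e h a)
  show ?case
  proof (rule W.W_step[OF W_step.IH W_step.hyps(2,3)])
    fix c assume "c \<in> pts L"
    from eqv_mult[OF eqv_refl[of b] W_step.hyps(4)[OF this]]
    show "b * h c \<simeq> b * f c + (b * a) * mon e c" by (simp add: algebra_simps)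
  qed
qed

lemma W_minus: "f \<in> W L s \<Longrightarrow> (\<lambda>c. - f c) \<in> W L s"
  using W_scale[of f L s "-1"] by simp

lemma W_diff: "f \<in> W L s \<Longrightarrow> g \<in> W L s \<Longrightarrow> (\<lambda>c. f c - g c) \<in> W L s"
  using W_add[OF _ W_minus] by simp

lemma W_sum:
  assumes "\<And>i. i \<in> S \<Longrightarrow> f i \<in> W L s"
  shows "(\<lambda>c. \<Sum>i\<in>S. f i c) \<in> W L s"
  using assms by (induction S rule: infinite_finite_induct) (auto intro: W_zero W_add)

lemma W_mono: "f \<in> W L s \<Longrightarrow> s \<le> s' \<Longrightarrow> f \<in> W L s'"
proof (induction rule: W.induct)
  case (W_step f e h a)
  then show ?case using W.W_step[of f L s' e h a] by simp
qed (rule W.W_zero)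

lemma W_mon: "length e = Suc L \<Longrightarrow> wt e < s \<Longrightarrow> mon e \<in> W L s"
  by (rule W_step[of "\<lambda>_. 0" _ _ e _ 1]) (auto intro: W_zero)

lemma W_0: "f \<in> W L 0 \<longleftrightarrow> (\<forall>c\<in>pts L. f c \<simeq> 0)"
  by (auto intro: W_zero elim: W.cases)

lemma W_mon_mult:
  assumes "f \<in> W L s" "length e = Suc L"
  shows "(\<lambda>c. mon e c * f c) \<in> W L (s + wt e)"
  using assms(1)
proof induction
  case (W_zero f)
  then show ?case by (intro W.W_zero) (simp add: eqv_mult_zero)
next
  case (W_step f e' h a)
  show ?case
  proof (rule W.W_step[OF W_step.IH, of "map2 (+) e e'"])
    show "length (map2 (+) e e') = Suc L" "wt (map2 (+) e e') < s + wt e"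
      using W_step.hyps assms by (simp_all add: wt_add)
    fix c assume "c \<in> pts L"
    from eqv_mult[OF eqv_refl[of "mon e c"] W_step.hyps(4)[OF this]]
    show "mon e c * h c \<simeq> mon e c * f c + a * mon (map2 (+) e e') c"
      using W_step.hyps assms by (simp add: mon_add algebra_simps)
  qed
qed

text \<open>Pole orders add up. The bound \<open>Suc t\<close> says that \<open>g\<close> has order
  at most \<open>t\<close>, which is why the product lands in \<open>s + t\<close> rather than
  \<open>s + Suc t\<close>.\<close>

lemma W_mult:
  assumes "g \<in> W L (Suc t)" "f \<in> W L s"
  shows "(\<lambda>c. g c * f c) \<in> W L (s + t)"
  using assms(1)
proof induction
  case (W_zero g)
  then show ?case using eqv_mult_zero[OF W_zero] by (intro W.W_zero) (simp add: mult.commute)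
next
  case (W_step g e h a)
  have "(\<lambda>c. g c * f c + a * (mon e c * f c)) \<in> W L (s + t)"
    by (intro W_add W_step.IH W_scale W_mono[OF W_mon_mult[OF assms(2)]]) (use W_step.hyps in auto)
  then show ?case
  proof (rule W_cong)
    fix c assume "c \<in> pts L"
    from eqv_mult[OF W_step.hyps(4)[OF this] eqv_refl[of "f c"]]
    show "h c * f c \<simeq> g c * f c + a * (mon e c * f c)" by (simp add: algebra_simps)
  qed
qed

text \<open>Passage from level \<open>L\<close> to the next one: the second hypothesis bounds the
  weight of \<open>b # e\<close> for every monomial \<open>e\<close> of weight
  \<open>w\<close>.\<close>

lemma W_lift:
  assumes "f \<in> W L s" "\<And>w. w < s \<Longrightarrow> q * w + b * (q + 1) ^ Suc L < s'"
  shows "(\<lambda>c. hd c ^ b * f (tl c)) \<in> W (Suc L) s'"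
  using assms(1)
proof induction
  case (W_zero f)
  show ?case
    by (intro W.W_zero) (use W_zero in \<open>force intro: eqv_mult_zero\<close>)
next
  case (W_step f e h a)
  show ?case
  proof (rule W.W_step[OF W_step.IH, of "b # e"])
    show "length (b # e) = Suc (Suc L)" using W_step.hyps by simp
    show "wt (b # e) < s'" using W_step.hyps assms(2) by simp
    fix c assume "c \<in> pts (Suc L)"
    then obtain y c' where c: "c = y # c'" "c' \<in> pts L" by auto
    from eqv_mult[OF eqv_refl[of "y ^ b"] W_step.hyps(4)[OF c(2)]]
    show "hd c ^ b * h (tl c) \<simeq> hd c ^ b * f (tl c) + a * mon (b # e) c"
      using c by (simp add: algebra_simps)
  qed
qed

section \<open>Reduced monomials and leading terms\<close>

text \<open>The last exponent belongs to the base coordinate. No tower equation lowers powers of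
  that coordinate, hence \<open>butlast\<close>.\<close>

definition reduced :: "nat list \<Rightarrow> bool" where
  "reduced e \<longleftrightarrow> (\<forall>b\<in>set (butlast e). b < q)"

lemma reduced_Cons: "e \<noteq> [] \<Longrightarrow> reduced (b # e) \<longleftrightarrow> b < q \<and> reduced e"
  by (simp add: reduced_def)

text \<open>The tower equation replaces \<open>y ^ q\<close> by \<open>x ^ Suc q - y\<close>. The
  first term has the same weight as \<open>y ^ q\<close> and the second a smaller one, so the
  exponent of \<open>y\<close> drops below \<open>q\<close> at the price of lower-order
  terms.\<close>

lemma reduce:
  "length e = Suc L \<Longrightarrow>
    \<exists>e'. length e' = Suc L \<and> reduced e' \<and> wt e' = wt e \<and> (\<lambda>c. mon e c - mon e' c) \<in> W L (wt e)"
proof (induction L arbitrary: e)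
  case 0
  then obtain a where "e = [a]" by (auto simp: length_Suc_conv)
  then show ?case by (intro exI[of _ e]) (auto simp: reduced_def intro: W_zero)
next
  case (Suc L)
  then obtain b h r where e: "e = b # h # r" "length r = L"
    by (auto simp: length_Suc_conv)
  have "\<exists>e'. length e' = Suc (Suc L) \<and> reduced e' \<and> wt e' = wt (b # h # r) \<and>
    (\<lambda>c. mon (b # h # r) c - mon e' c) \<in> W (Suc L) (wt (b # h # r))"
  \<comment> \<open>Each replacement raises the next exponent \<open>h\<close> by
    \<open>q + 1\<close>, so \<open>h\<close> has to be arbitrary.\<close>
  proof (induction b arbitrary: h rule: less_induct)
    case (less b)
    show ?case
    proof (cases "b < q")
      case True
      from e(2) Suc.IH[of "h # r"] obtain e' where e': "length e' = Suc L" "reduced e'"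
        "wt e' = wt (h # r)" "(\<lambda>c. mon (h # r) c - mon e' c) \<in> W L (wt (h # r))"
        by auto
      have "(\<lambda>c. hd c ^ b * (mon (h # r) (tl c) - mon e' (tl c))) \<in> W (Suc L) (wt (b # h # r))"
        by (rule W_lift[OF e'(4)]) (use e(2) q_ge_2 in simp)
      then have "(\<lambda>c. mon (b # h # r) c - mon (b # e') c) \<in> W (Suc L) (wt (b # h # r))"
        by (rule W_cong) (auto simp: algebra_simps)
      with e' True show ?thesis
        by (intro exI[of _ "b # e'"]) (use reduced_Cons[of e' b] e(2) in \<open>auto simp: length_Suc_conv\<close>)
    next
      case False
      \<comment> \<open>\<open>e2\<close> and \<open>e3\<close> are the exponents of the two terms
        that the replacement produces: \<open>e2\<close> keeps the weight, \<open>e3\<close> lowers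
        it.\<close>
      define e2 where "e2 = (b - q) # (h + q + 1) # r"
      have w2: "wt e2 = wt (b # h # r)"
      proof -
        obtain k where k: "b = q + k" using False le_Suc_ex[of q b] by auto
        show ?thesis unfolding e2_def k by (simp add: algebra_simps)
      qed
      from False q_ge_2 have "b - q < b" by simp
      from less.IH[OF this, of "h + q + 1"] obtain e' where e': "length e' = Suc (Suc L)" "reduced e'"
        "wt e' = wt e2" "(\<lambda>c. mon e2 c - mon e' c) \<in> W (Suc L) (wt e2)"
        by (auto simp: e2_def)
      define e3 where "e3 = (b - q + 1) # h # r"
      have w3: "wt e3 < wt (b # h # r)"
      proof -
        have "b - q + 1 < b" using False q_ge_2 by simp
        then have "(b - q + 1) * (q + 1) ^ length (h # r) < b * (q + 1) ^ length (h # r)"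
          by (intro mult_strict_right_mono) auto
        then show ?thesis unfolding e3_def wt.simps(2) by (simp only: add_less_cancel_left)
      qed
      have "(\<lambda>c. mon e2 c - mon e' c - mon e3 c) \<in> W (Suc L) (wt (b # h # r))"
        using W_diff[OF e'(4)[unfolded w2] W_mon[OF _ w3]] e(2) by (simp add: e3_def)
      then have "(\<lambda>c. mon (b # h # r) c - mon e' c) \<in> W (Suc L) (wt (b # h # r))"
      proof (rule W_cong)
        fix c' assume "c' \<in> pts (Suc L)"
        then obtain y c where c: "c' = y # c" "c \<in> pts L" "y \<in> fibre c" by (rule pts_SucE)
        from c(2) obtain x r' where x: "c = x # r'" by (metis length_pts length_Suc_conv)
        obtain k where k: "b = q + k" using False le_Suc_ex[of q b] by auto
        have "y ^ q + y \<simeq> x ^ Suc q" using c(3) x by (simp add: fibre_def)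
        from eqv_diff[OF this eqv_refl[of y]] have "y ^ q \<simeq> x ^ Suc q - y" by simp
        from eqv_mult[OF this eqv_refl[of "y ^ k * x ^ h * mon r r'"]]
        have "mon (b # h # r) c' \<simeq> mon e2 c' - mon e3 c'"
          unfolding c(1) x e2_def e3_def k by (simp add: algebra_simps power_add)
        from eqv_diff[OF this eqv_refl[of "mon e' c'"]]
        show "mon (b # h # r) c' - mon e' c' \<simeq> mon e2 c' - mon e' c' - mon e3 c'"
          by (simp add: algebra_simps)
      qed
      with e' w2 show ?thesis by (intro exI[of _ e']) (simp del: mon.simps wt.simps)
    qed
  qed
  with e(1) show ?case by simp
qed

text \<open>Powers of \<open>q + 1\<close> are 1 modulo \<open>q\<close>, so the weight modulo
  \<open>q\<close> is the head exponent. The weight of the tail follows, and the exponents can be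
  read off one by one.\<close>

lemma reduced_unique:
  "length e = Suc L \<Longrightarrow> length e' = Suc L \<Longrightarrow> reduced e \<Longrightarrow> reduced e' \<Longrightarrow> wt e = wt e' \<Longrightarrow> e = e'"
proof (induction L arbitrary: e e')
  case 0
  then show ?case by (auto simp: length_Suc_conv)
next
  case (Suc L)
  obtain b r where "e = b # r" "length r = Suc L" using Suc.prems(1) by (cases e) auto
  moreover obtain b' r' where "e' = b' # r'" "length r' = Suc L" using Suc.prems(2) by (cases e') auto
  ultimately have e: "e = b # r" "length r = Suc L" "e' = b' # r'" "length r' = Suc L" by simp_all
  then have "r \<noteq> []" "r' \<noteq> []" by auto
  then have red: "b < q" "reduced r" "b' < q" "reduced r'"
    using Suc.prems(3,4) reduced_Cons unfolding e by auto
  have *: "wt (k # s) mod q = k mod q" for k s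
  proof -
    have "(q + 1) ^ n mod q = 1 mod q" for n
      by (induction n) simp_all
    then have "(k * (q + 1) ^ length s) mod q = k mod q"
      by (metis mod_mult_right_eq mult.right_neutral)
    then show ?thesis by (simp)
  qed
  have b: "b = b'" using *[of b r] *[of b' r'] Suc.prems(5) red unfolding e by (metis mod_less)
  then have "wt r = wt r'" using Suc.prems(5) e q_ge_2 by simp
  then show ?case using Suc.IH[of r r'] red e b by simp
qed

lemma mon_same_wt:
  assumes "length e = Suc L" "length e' = Suc L" "wt e = wt e'"
  shows "(\<lambda>c. mon e c - mon e' c) \<in> W L (wt e)"
proof -
  from reduce[OF assms(1)] obtain r where r: "length r = Suc L" "reduced r" "wt r = wt e"
    "(\<lambda>c. mon e c - mon r c) \<in> W L (wt e)" by auto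
  from reduce[OF assms(2)] obtain r' where r': "length r' = Suc L" "reduced r'" "wt r' = wt e'"
    "(\<lambda>c. mon e' c - mon r' c) \<in> W L (wt e')" by auto
  have "r = r'" by (rule reduced_unique) (use r r' assms in auto)
  with r'(4) assms(3) have "(\<lambda>c. mon e' c - mon r c) \<in> W L (wt e)" by simp
  from W_diff[OF r(4) this] show ?thesis by simp
qed

text \<open>Monomials of weight \<open>s\<close> agree up to lower order by
  \<open>mon_same_wt\<close>, so any one of them spans the quotient of two consecutive
  spaces.\<close>

lemma W_Suc:
  assumes "f \<in> W L (Suc s)" "length e = Suc L" "wt e = s"
  shows "\<exists>a. (\<lambda>c. f c - a * mon e c) \<in> W L s"
  using assms(1)
proof induction
  case (W_zero f)
  then show ?case by (intro exI[of _ 0] W.W_zero) simp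
next
  case (W_step f e' h a)
  then obtain a' where a': "(\<lambda>c. f c - a' * mon e c) \<in> W L s" by auto
  have "\<exists>a'. (\<lambda>c. f c + a * mon e' c - a' * mon e c) \<in> W L s"
  proof (cases "wt e' = s")
    case True
    then have "(\<lambda>c. f c - a' * mon e c + a * (mon e' c - mon e c)) \<in> W L s"
      by (intro W_add a' W_scale) (use mon_same_wt[of e' L e] assms W_step.hyps in auto)
    then show ?thesis by (intro exI[of _ "a' + a"]) (simp add: algebra_simps)
  next
    case False
    have "(\<lambda>c. f c - a' * mon e c + a * mon e' c) \<in> W L s"
      by (intro W_add a' W_scale W_mon) (use W_step.hyps False in auto)
    then show ?thesis by (intro exI[of _ "a'"]) (simp add: algebra_simps)
  qed
  then obtain a'' where a'': "(\<lambda>c. f c + a * mon e' c - a'' * mon e c) \<in> W L s" by auto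
  show ?case
    by (intro exI[of _ a''] W_cong[OF a'']) (use W_step.hyps(4) in \<open>auto intro: eqv_diff\<close>)
qed

text \<open>This covers a weight that no monomial attains as well as one whose monomials are
  redundant as functions on the points.\<close>

lemma W_Suc_none:
  assumes "f \<in> W L (Suc s)" "\<And>e. length e = Suc L \<Longrightarrow> wt e = s \<Longrightarrow> mon e \<in> W L s"
  shows "f \<in> W L s"
  using assms(1)
proof induction
  case (W_zero f)
  then show ?case by (intro W.W_zero)
next
  case (W_step f e' h a)
  have "mon e' \<in> W L s"
    using W_step.hyps assms(2)[of e'] W_mon[of e' L s] by (cases "wt e' = s") auto
  then have "(\<lambda>c. f c + a * mon e' c) \<in> W L s"
    by (intro W_add W_step.IH W_scale)
  then show ?case by (rule W_cong) (use W_step.hyps in auto)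
qed

lemma Nil_pts [simp]: "[] \<notin> pts L"
  using length_pts by fastforce

lemma qq_gt_1: "1 < q * q"
  using mult_le_mono[OF q_ge_2 q_ge_2] by simp

section \<open>Counting functions of bounded pole order\<close>

text \<open>A normal form: values in \<open>C\<close> on the points and undefined elsewhere, so that
  functions modulo congruence form a finite set and cardinalities replace dimensions.\<close>

definition canon :: "nat \<Rightarrow> ('a list \<Rightarrow> 'a) \<Rightarrow> 'a list \<Rightarrow> 'a"
  where "canon L f = restrict (\<lambda>c. rep (f c)) (pts L)"

definition Wc :: "nat \<Rightarrow> nat \<Rightarrow> ('a list \<Rightarrow> 'a) set"
  where "Wc L s = W L s \<inter> (pts L \<rightarrow>\<^sub>E C)"

lemma canon_PiE: "canon L f \<in> pts L \<rightarrow>\<^sub>E C"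
  by (auto simp: canon_def rep)

lemma canon_eqv: "c \<in> pts L \<Longrightarrow> canon L f c \<simeq> f c"
  by (simp add: canon_def rep eqv_sym)

lemma canon_eqI: "f \<in> pts L \<rightarrow>\<^sub>E C \<Longrightarrow> (\<And>c. c \<in> pts L \<Longrightarrow> f c \<simeq> g c) \<Longrightarrow> canon L g = f"
proof (rule extensionalityI[of _ "pts L"])
  assume f: "f \<in> pts L \<rightarrow>\<^sub>E C" and fg: "\<And>c. c \<in> pts L \<Longrightarrow> f c \<simeq> g c"
  show "canon L g c = f c" if "c \<in> pts L" for c
    using rep_unique[of "f c" "g c"] eqv_sym[OF fg[OF that]] that f by (auto simp: canon_def)
qed (auto simp: canon_def PiE_def)

lemma canon_Wc:
  assumes "f \<in> W L s"
  shows "canon L f \<in> Wc L s"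
  unfolding Wc_def by (intro IntI W_cong[OF assms] canon_eqv canon_PiE)

lemma finite_Wc: "finite (Wc L s)"
  unfolding Wc_def by (intro finite_Int disjI2 finite_PiE finite_pts finite_C)

lemma card_Wc_0: "card (Wc L 0) = 1"
proof -
  have "Wc L 0 = {canon L (\<lambda>_. 0)}"
    using canon_Wc[of "\<lambda>_. 0" L 0] by (auto simp: W_0 Wc_def intro!: canon_eqI[symmetric])
  then show ?thesis by simp
qed

text \<open>The quotient of consecutive spaces has dimension at most 1 over a field with
  \<open>q * q\<close> elements.\<close>

lemma card_Wc_Suc: "card (Wc L (Suc s)) \<le> q * q * card (Wc L s)"
proof (cases "\<exists>e. length e = Suc L \<and> wt e = s")
  case True
  then obtain e where e: "length e = Suc L" "wt e = s" by auto
  have "Wc L (Suc s) \<subseteq> (\<lambda>(a, g). canon L (\<lambda>c. g c + a * mon e c)) ` (C \<times> Wc L s)"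
  proof
    fix f assume "f \<in> Wc L (Suc s)"
    then have f: "f \<in> W L (Suc s)" "f \<in> pts L \<rightarrow>\<^sub>E C" by (auto simp: Wc_def)
    from W_Suc[OF f(1) e] obtain a where a: "(\<lambda>c. f c - a * mon e c) \<in> W L s" by auto
    define g where "g = canon L (\<lambda>c. f c - a * mon e c)"
    have "f = canon L (\<lambda>c. g c + rep a * mon e c)"
    proof (rule canon_eqI[OF f(2), symmetric])
      fix c assume "c \<in> pts L"
      then have "g c \<simeq> f c - a * mon e c" unfolding g_def by (rule canon_eqv)
      from eqv_add[OF this eqv_mult[OF eqv_sym[OF rep(2)[of a]] eqv_refl[of "mon e c"]]]
      show "f c \<simeq> g c + rep a * mon e c" by (simp add: eqv_sym)
    qed
    moreover have "g \<in> Wc L s" unfolding g_def by (rule canon_Wc[OF a])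
    ultimately show "f \<in> (\<lambda>(a, g). canon L (\<lambda>c. g c + a * mon e c)) ` (C \<times> Wc L s)"
      using rep(1)[of a] by force
  qed
  from surj_card_le[OF _ this] show ?thesis
    by (simp add: card_cartesian_product card_C finite_C finite_Wc)
next
  case False
  then have "Wc L (Suc s) \<subseteq> Wc L s" by (auto simp: Wc_def intro: W_Suc_none)
  then have "card (Wc L (Suc s)) \<le> 1 * card (Wc L s)" by (simp add: card_mono finite_Wc)
  also have "\<dots> \<le> q * q * card (Wc L s)" using q_ge_2 by (intro mult_right_mono) auto
  finally show ?thesis .
qed

text \<open>\<open>M\<close> contains every order at which the filtration grows, and each growth
  costs a factor of at most \<open>q * q\<close>.\<close>

lemma card_Wc_le:
  assumes "\<And>w f. w \<notin> M \<Longrightarrow> f \<in> W L (Suc w) \<Longrightarrow> f \<in> W L w"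
  shows "card (Wc L s) \<le> (q * q) ^ card {w \<in> M. w < s}"
proof (induction s)
  case 0
  then show ?case by (simp add: card_Wc_0)
next
  case (Suc s)
  show ?case
  proof (cases "s \<in> M")
    case True
    then have "{w \<in> M. w < Suc s} = insert s {w \<in> M. w < s}" by auto
    then have "card {w \<in> M. w < Suc s} = Suc (card {w \<in> M. w < s})" by simp
    then show ?thesis using order_trans[OF card_Wc_Suc mult_left_mono[OF Suc]] by simp
  next
    case False
    then have "{w \<in> M. w < Suc s} = {w \<in> M. w < s}" by (auto simp: less_Suc_eq)
    moreover have "Wc L (Suc s) \<subseteq> Wc L s" using assms[OF False] by (auto simp: Wc_def)
    then have "card (Wc L (Suc s)) \<le> card (Wc L s)" by (simp add: card_mono finite_Wc)
    ultimately show ?thesis using Suc by simp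
  qed
qed

lemma card_Wc_le_power: "card (Wc L s) \<le> (q * q) ^ s"
  using card_Wc_le[of UNIV L s] by simp

section \<open>Interpolation on the tower\<close>

lemma poly_eq_sum:
  fixes p :: "'a poly"
  assumes "\<And>b. n \<le> b \<Longrightarrow> poly.coeff p b = 0"
  shows "poly p y = (\<Sum>b<n. y ^ b * poly.coeff p b)"
proof -
  have "poly p y = (\<Sum>b\<le>degree p. poly.coeff p b * y ^ b)" by (rule poly_altdef)
  also have "\<dots> = (\<Sum>b\<in>{..degree p} \<inter> {..<n}. poly.coeff p b * y ^ b)"
    by (rule sum.mono_neutral_right) (use assms in \<open>auto simp: not_less\<close>)
  also have "\<dots> = (\<Sum>b<n. poly.coeff p b * y ^ b)"
    by (rule sum.mono_neutral_left) (auto intro: le_degree)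
  finally show ?thesis by (simp add: mult.commute)
qed

lemma lagrange:
  assumes "F \<subseteq> C"
  shows "\<exists>p. (\<forall>b\<ge>card F. poly.coeff p b = 0) \<and> (\<forall>y\<in>F. poly p y \<simeq> h y)"
  using finite_subset[OF assms finite_C] assms
proof induction
  case empty
  show ?case by (intro exI[of _ 0]) simp
next
  case (insert z F)
  then obtain p where p: "\<And>b. b \<ge> card F \<Longrightarrow> poly.coeff p b = 0" "\<And>y. y \<in> F \<Longrightarrow> poly p y \<simeq> h y"
    by auto
  \<comment> \<open>Newton interpolation: \<open>Q\<close> vanishes on \<open>F\<close>, and its
    value at \<open>z\<close> is invertible modulo \<open>I\<close> because distinct representatives
    are incongruent. A multiple of \<open>Q\<close> therefore corrects the value at \<open>z\<close>
    alone.\<close>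
  define Q where "Q = (\<Prod>u\<in>F. [:-u, 1:])"
  have "degree Q \<le> (\<Sum>u\<in>F. degree [:-u, 1:])"
    unfolding Q_def using degree_prod_sum_le[OF insert.hyps(1), of "\<lambda>u. [:-u, 1:]"] by (simp add: o_def)
  also have "\<dots> \<le> card F" by (simp add: degree_pCons_eq_if)
  finally have degQ: "degree Q \<le> card F" .
  have polyQ: "poly Q y = (\<Prod>u\<in>F. y - u)" for y
    by (simp add: Q_def poly_prod)
  have "\<not> (\<Prod>u\<in>F'. z - u) \<simeq> 0" if "F' \<subseteq> F" for F'
    using finite_subset[OF that insert.hyps(1)] that
  proof induction
    case (insert u F')
    have "u \<noteq> z" "u \<in> C" "z \<in> C" using insert insert.prems \<open>z \<notin> F\<close> \<open>insert z F \<subseteq> C\<close> by auto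
    then have "\<not> z - u \<simeq> 0" using C_eqv_imp_eq[of z u] eqv_diff_zero by auto
    then show ?case using insert by (simp add: mult_eqv_zero_iff)
  qed (simp add: one_not_zero)
  from this[OF subset_refl] obtain v where v: "poly Q z * v \<simeq> 1"
    using inverse_ex polyQ by metis
  define k where "k = (h z - poly p z) * v"
  define p' where "p' = p + Polynomial.smult k Q"
  have "poly.coeff p' b = 0" if "b \<ge> card (insert z F)" for b
    using that insert.hyps degQ p(1)[of b] by (simp add: p'_def coeff_eq_0)
  moreover have "poly p' y \<simeq> h y" if "y \<in> insert z F" for y
  proof (cases "y = z")
    case True
    from eqv_add[OF eqv_refl[of "poly p z"] eqv_mult[OF v eqv_refl[of "h z - poly p z"]]]
    show ?thesis by (simp add: True p'_def k_def algebra_simps)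
  next
    case False
    then have "y \<in> F" using that by simp
    then have "poly Q y = 0" using insert.hyps(1) unfolding polyQ by (intro prod_zero) auto
    then show ?thesis using p(2)[OF \<open>y \<in> F\<close>] by (simp add: p'_def)
  qed
  ultimately show ?case by blast
qed

text \<open>Polynomials of degree below \<open>B\<close> in the newest coordinate with coefficients
  from \<open>W L s\<close>. Restricting this degree lets the dimension be tuned more finely than by
  whole levels of the tower.\<close>

definition P :: "nat \<Rightarrow> nat \<Rightarrow> nat \<Rightarrow> ('a list \<Rightarrow> 'a) set" where
  "P L B s = {f. \<exists>R. (\<forall>b<B. R b \<in> W L s) \<and>
      (\<forall>c\<in>pts (Suc L). f c \<simeq> (\<Sum>b<B. hd c ^ b * R b (tl c)))}"

lemma P_subset_W:
  assumes "f \<in> P L B s" "\<And>w b. w < s \<Longrightarrow> b < B \<Longrightarrow> q * w + b * (q + 1) ^ Suc L < s'"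
  shows "f \<in> W (Suc L) s'"
proof -
  from assms(1) obtain R where R: "\<And>b. b < B \<Longrightarrow> R b \<in> W L s"
    "\<And>c. c \<in> pts (Suc L) \<Longrightarrow> f c \<simeq> (\<Sum>b<B. hd c ^ b * R b (tl c))"
    unfolding P_def by blast
  have "(\<lambda>c. \<Sum>b<B. hd c ^ b * R b (tl c)) \<in> W (Suc L) s'"
    by (intro W_sum W_lift[OF R(1)]) (use assms(2) in auto)
  then show ?thesis by (rule W_cong) (use R(2) in auto)
qed

text \<open>First interpolate within every fibre by a polynomial in the new coordinate, then
  interpolate each of its coefficients as a function on level \<open>L\<close>.\<close>

lemma interpolate_P:
  assumes "\<And>h. \<exists>f\<in>W L s. \<forall>c\<in>pts L. last c \<in> S \<longrightarrow> f c \<simeq> h c"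
    and F: "\<And>c. c \<in> pts L \<Longrightarrow> F c \<subseteq> C \<and> card (F c) \<le> B"
  shows "\<exists>f\<in>P L B s. \<forall>c\<in>pts L. \<forall>y\<in>F c. last c \<in> S \<longrightarrow> y # c \<in> pts (Suc L) \<longrightarrow> f (y # c) \<simeq> h (y # c)"
proof -
  have "\<exists>p. (\<forall>b\<ge>B. poly.coeff p b = 0) \<and> (\<forall>y\<in>F c. poly p y \<simeq> h (y # c))" if "c \<in> pts L" for c
  proof -
    from F[OF that] have FC: "F c \<subseteq> C" "card (F c) \<le> B" by simp_all
    from lagrange[OF FC(1), of "\<lambda>y. h (y # c)"] obtain p
      where "\<forall>b\<ge>card (F c). poly.coeff p b = 0" "\<forall>y\<in>F c. poly p y \<simeq> h (y # c)" by blast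
    with FC(2) show ?thesis by (intro exI[of _ p]) auto
  qed
  then obtain p where p: "\<And>c b. c \<in> pts L \<Longrightarrow> b \<ge> B \<Longrightarrow> poly.coeff (p c) b = 0"
    "\<And>c y. c \<in> pts L \<Longrightarrow> y \<in> F c \<Longrightarrow> poly (p c) y \<simeq> h (y # c)"
    by metis
  have "\<exists>f\<in>W L s. \<forall>c\<in>pts L. last c \<in> S \<longrightarrow> f c \<simeq> poly.coeff (p c) b" for b
    by (rule assms(1))
  then obtain R where R: "\<And>b. R b \<in> W L s"
    "\<And>b c. c \<in> pts L \<Longrightarrow> last c \<in> S \<Longrightarrow> R b c \<simeq> poly.coeff (p c) b"
    by metis
  have "(\<lambda>c. \<Sum>b<B. hd c ^ b * R b (tl c)) \<in> P L B s"
    unfolding P_def by (intro CollectI exI[of _ R] conjI allI ballI impI R(1) eqv_refl)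
  moreover have "(\<Sum>b<B. y ^ b * R b c) \<simeq> h (y # c)" if "c \<in> pts L" "y \<in> F c" "last c \<in> S" for y c
  proof -
    have "(\<Sum>b<B. y ^ b * R b c) \<simeq> (\<Sum>b<B. y ^ b * poly.coeff (p c) b)"
      by (intro eqv_sum eqv_mult R eqv_refl that)
    also have "\<dots> = poly (p c) y" using poly_eq_sum[of B "p c" y] p(1) that by simp
    also have "\<dots> \<simeq> h (y # c)" by (rule p(2)) fact+
    finally show ?thesis .
  qed
  ultimately show ?thesis by (intro bexI) auto
qed

text \<open>The weight of the monomial with exponent \<open>q - 1\<close> in every coordinate except
  the base, where it is 0: the share of the upper coordinates in the order of an
  interpolant.\<close>

primrec G :: "nat \<Rightarrow> nat" where
  "G 0 = 0"
| "G (Suc L) = q * G L + (q - 1) * (q + 1) ^ Suc L"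

text \<open>Degree below \<open>A\<close> suffices in the base coordinate, and degree below
  \<open>q\<close> in every further one, since fibres have \<open>q\<close> points.\<close>

lemma interpolate_W:
  assumes "S \<subseteq> C" "card S \<le> A"
  shows "\<exists>f\<in>W L (A * q ^ L + G L). \<forall>c\<in>pts L. last c \<in> S \<longrightarrow> f c \<simeq> h c"
proof (induction L arbitrary: h)
  case 0
  from lagrange[OF assms(1), of "\<lambda>x. h [x]"] assms(2)
  obtain p where p: "\<And>b. b \<ge> A \<Longrightarrow> poly.coeff p b = 0" "\<And>y. y \<in> S \<Longrightarrow> poly p y \<simeq> h [y]"
    by (meson order_trans)
  have "(\<lambda>c. \<Sum>b<A. poly.coeff p b * mon [b] c) \<in> W 0 A"
    by (intro W_sum W_scale W_mon) auto
  moreover have "(\<Sum>b<A. poly.coeff p b * mon [b] [y]) \<simeq> h [y]" if "y \<in> S" for y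
    using p(2)[OF that] poly_eq_sum[of A p y] p(1) by (simp add: mult.commute)
  ultimately show ?case by (intro bexI[of _ "\<lambda>c. \<Sum>b<A. poly.coeff p b * mon [b] c"]) auto
next
  case (Suc L)
  from interpolate_P[where F = fibre and B = q, OF Suc.IH]
  obtain f where f: "f \<in> P L q (A * q ^ L + G L)"
    "\<And>c y. c \<in> pts L \<Longrightarrow> y \<in> fibre c \<Longrightarrow> last c \<in> S \<Longrightarrow> y # c \<in> pts (Suc L) \<Longrightarrow> f (y # c) \<simeq> h (y # c)"
    using fibre_C card_fibre' by (metis order_refl)
  have "f \<in> W (Suc L) (A * q ^ Suc L + G (Suc L))"
  proof (rule P_subset_W[OF f(1)])
    fix w b assume "w < A * q ^ L + G L" "b < q"
    then have "q * w < q * (A * q ^ L + G L)" "b * (q + 1) ^ Suc L \<le> (q - 1) * (q + 1) ^ Suc L"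
      by (auto intro!: mult_right_mono)
    then show "q * w + b * (q + 1) ^ Suc L < A * q ^ Suc L + G (Suc L)"
      by (simp add: algebra_simps)
  qed
  moreover have "f c \<simeq> h c" if c: "c \<in> pts (Suc L)" "last c \<in> S" for c
  proof -
    from c(1) obtain y c' where y: "c = y # c'" "c' \<in> pts L" "y \<in> fibre c'" by (rule pts_SucE)
    have "c' \<noteq> []" using length_pts[OF y(2)] by auto
    then show ?thesis using f(2)[OF y(2,3)] c y(1) by simp
  qed
  ultimately show ?case by blast
qed

section \<open>Independence of the reduced monomials\<close>

text \<open>The bound on the base exponent comes from \<open>x ^ (q * q) \<simeq> x\<close>; with it
  there are at most as many monomials as points.\<close>

definition Red :: "nat \<Rightarrow> nat list set" where
  "Red L = {e. length e = Suc L \<and> reduced e \<and> last e < q * q}"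

lemma card_Red: "finite (Red L) \<and> card (Red L) \<le> q ^ (L + 2)"
proof (induction L)
  case 0
  have *: "Red 0 \<subseteq> (\<lambda>a. [a]) ` {..<q * q}"
    by (auto simp: Red_def length_Suc_conv)
  show ?case using finite_surj[OF _ *] surj_card_le[OF _ *] by (simp add: power2_eq_square)
next
  case (Suc L)
  have *: "Red (Suc L) \<subseteq> (\<lambda>(b, e). b # e) ` ({..<q} \<times> Red L)"
  proof
    fix e assume "e \<in> Red (Suc L)"
    then show "e \<in> (\<lambda>(b, e). b # e) ` ({..<q} \<times> Red L)"
      by (cases e) (auto simp: Red_def reduced_def split: if_splits)
  qed
  have "card (Red (Suc L)) \<le> q * card (Red L)"
    using surj_card_le[OF _ *] Suc by (simp add: card_cartesian_product)
  also have "\<dots> \<le> q * q ^ (L + 2)" using Suc by (intro mult_left_mono) auto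
  finally show ?case using finite_surj[OF _ *] Suc by simp
qed

text \<open>Since \<open>x ^ (q * q) \<simeq> x\<close> at every point, such a monomial equals one
  of smaller weight as a function.\<close>

lemma mon_high_W: "length e = Suc L \<Longrightarrow> q * q \<le> last e \<Longrightarrow> mon e \<in> W L (wt e)"
proof (induction L arbitrary: e)
  case 0
  then obtain a where a: "e = [q * q + a]" by (auto simp: length_Suc_conv le_iff_add)
  have "q * 2 \<le> q * q" using q_ge_2 by (intro mult_left_mono) auto
  then have "mon [a + 1] \<in> W 0 (wt e)" using qq_gt_1 by (intro W_mon) (auto simp: a)
  then show ?case
  proof (rule W_cong)
    fix c assume "c \<in> pts 0"
    then obtain x where x: "c = [x]" by auto
    have "x ^ (q * q) \<simeq> x" using power_qq by (simp add: eqv_def)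
    from eqv_mult[OF this eqv_refl[of "x ^ a"]]
    show "mon e c \<simeq> mon [a + 1] c" by (simp add: a x power_add)
  qed
next
  case (Suc L)
  then obtain b e' where e: "e = b # e'" "length e' = Suc L" by (auto simp: length_Suc_conv)
  then have "mon e' \<in> W L (wt e')" using Suc by (auto split: if_splits)
  then have "(\<lambda>c. hd c ^ b * mon e' (tl c)) \<in> W (Suc L) (wt e)"
    by (rule W_lift) (use e q_ge_2 in auto)
  then show ?case by (rule W_cong) (auto simp: e)
qed

text \<open>Interpolation over all base values yields every function on the points, so the
  cardinality is known exactly.\<close>

lemma card_Wc_full: "card (Wc L (q * q * q ^ L + G L)) = (q * q) ^ (q ^ (L + 2))"
proof -
  have "h \<in> W L (q * q * q ^ L + G L)" if h: "h \<in> pts L \<rightarrow>\<^sub>E C" for h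
  proof -
    have last: "last c \<in> C" if "c \<in> pts L" for c
      using that by (induction L arbitrary: c) (use fibre_C in auto)
    obtain f where "f \<in> W L (q * q * q ^ L + G L)" "\<And>c. c \<in> pts L \<Longrightarrow> f c \<simeq> h c"
      using interpolate_W[of C "q * q" L h] card_C last by auto
    then show ?thesis using W_cong[of f] eqv_sym by auto
  qed
  then have "Wc L (q * q * q ^ L + G L) = (pts L \<rightarrow>\<^sub>E C)" by (auto simp: Wc_def)
  then show ?thesis by (simp add: card_PiE finite_pts card_C card_pts)
qed

text \<open>Counting: there are only as many reduced monomials as points, so all of them are needed
  to span the space of all functions.\<close>

lemma mon_Red_not_W:
  assumes "e \<in> Red L"
  shows "mon e \<notin> W L (wt e)"
proof
  assume e: "mon e \<in> W L (wt e)"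
  \<comment> \<open>If \<open>mon e\<close> were redundant, the filtration could grow only at the
    weights of the remaining reduced monomials, which are fewer than the points.\<close>
  define M where "M = wt ` (Red L - {e})"
  let ?s = "q * q * q ^ L + G L"
  have "card (Wc L ?s) \<le> (q * q) ^ card {w \<in> M. w < ?s}"
  proof (rule card_Wc_le)
    fix w f assume w: "w \<notin> M" "f \<in> W L (Suc w)"
    show "f \<in> W L w"
    proof (rule W_Suc_none[OF w(2)])
      fix e1 assume e1: "length e1 = Suc L" "wt e1 = w"
      from reduce[OF e1(1)] obtain r where r: "length r = Suc L" "reduced r" "wt r = wt e1"
        "(\<lambda>c. mon e1 c - mon r c) \<in> W L (wt e1)" by auto
      have "mon r \<in> W L w"
      proof (cases "last r < q * q")
        case True
        then have "r \<in> Red L" using r by (simp add: Red_def)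
        have "r = e"
        proof (rule ccontr)
          assume "r \<noteq> e"
          then have "wt r \<in> M" using \<open>r \<in> Red L\<close> by (simp add: M_def)
          with w(1) e1(2) r(3) show False by simp
        qed
        then show ?thesis using e r e1 by simp
      next
        case False
        then show ?thesis using mon_high_W[OF r(1)] r(3) e1(2) by simp
      qed
      from W_add[OF r(4)[unfolded e1(2)] this] show "mon e1 \<in> W L w" by simp
    qed
  qed
  moreover have "card {w \<in> M. w < ?s} < q ^ (L + 2)"
  proof -
    have fin: "finite (Red L)" "card (Red L) \<le> q ^ (L + 2)" using card_Red by auto
    have "card {w \<in> M. w < ?s} \<le> card M" by (rule card_mono) (auto simp: M_def fin)
    also have "\<dots> \<le> card (Red L - {e})" unfolding M_def by (rule card_image_le) (simp add: fin)
    also have "\<dots> < card (Red L)" using assms fin by (intro psubset_card_mono) auto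
    finally show ?thesis using fin by simp
  qed
  then have "(q * q) ^ card {w \<in> M. w < ?s} < (q * q) ^ (q ^ (L + 2))"
    by (intro power_strict_increasing qq_gt_1)
  ultimately show False by (simp add: card_Wc_full)
qed

section \<open>Leading terms of products and the number of zeros\<close>

lemma last_wt: "length e = Suc L \<Longrightarrow> last e * q ^ L \<le> wt e"
proof (induction L arbitrary: e)
  case 0
  then show ?case by (auto simp: length_Suc_conv)
next
  case (Suc L)
  then obtain b e' where e: "e = b # e'" "length e' = Suc L" by (auto simp: length_Suc_conv)
  then have "e' \<noteq> []" by auto
  then have "last e * q ^ Suc L = q * (last e' * q ^ L)" using e by simp
  also have "\<dots> \<le> q * wt e'" by (intro mult_left_mono Suc.IH e) simp
  also have "\<dots> \<le> wt e" by (simp add: e)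
  finally show ?case .
qed

text \<open>Descend through the filtration until \<open>f\<close> drops out of it; the step where
  this happens supplies the leading monomial.\<close>

lemma W_leading:
  assumes "f \<in> W L s" "\<exists>c\<in>pts L. \<not> f c \<simeq> 0"
  shows "\<exists>e a. length e = Suc L \<and> wt e < s \<and> \<not> a \<simeq> 0 \<and> (\<lambda>c. f c - a * mon e c) \<in> W L (wt e)"
  using assms(1)
proof (induction s)
  case 0
  then show ?case using assms(2) by (auto simp: W_0)
next
  case (Suc s)
  show ?case
  proof (cases "f \<in> W L s")
    case True
    then show ?thesis using Suc.IH less_SucI by blast
  next
    case False
    then obtain e where e: "length e = Suc L" "wt e = s" using W_Suc_none Suc.prems by blast
    from W_Suc[OF Suc.prems this] obtain a where a: "(\<lambda>c. f c - a * mon e c) \<in> W L s" by auto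
    have "\<not> a \<simeq> 0"
    proof
      assume "a \<simeq> 0"
      have "f \<in> W L s"
      proof (rule W_cong[OF a])
        fix c
        from eqv_diff[OF eqv_refl[of "f c"] eqv_mult_zero[OF \<open>a \<simeq> 0\<close>, of "mon e c"]]
        show "f c \<simeq> f c - a * mon e c" by (simp add: mult.commute eqv_sym)
      qed
      with False show False by simp
    qed
    then show ?thesis using e a by auto
  qed
qed

text \<open>The leading term of the product is the product of the leading terms. Its weight is below
  \<open>q ^ (L + 2)\<close>, so its reduced form belongs to \<open>Red L\<close> and cannot be of
  lower order.\<close>

lemma W_mult_nonzero:
  assumes f: "f \<in> W L s" "\<exists>c\<in>pts L. \<not> f c \<simeq> 0"
    and g: "g \<in> W L t" "\<exists>c\<in>pts L. \<not> g c \<simeq> 0"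
    and "s + t \<le> q ^ (L + 2) + 1"
  shows "\<exists>c\<in>pts L. \<not> f c * g c \<simeq> 0"
proof (rule ccontr)
  assume "\<not> ?thesis"
  then have zero: "f c * g c \<simeq> 0" if "c \<in> pts L" for c using that by blast
  from W_leading[OF f] obtain e a where e: "length e = Suc L" "wt e < s" "\<not> a \<simeq> 0"
    and f': "(\<lambda>c. f c - a * mon e c) \<in> W L (wt e)" by auto
  from W_leading[OF g] obtain e' a' where e': "length e' = Suc L" "wt e' < t" "\<not> a' \<simeq> 0"
    and g': "(\<lambda>c. g c - a' * mon e' c) \<in> W L (wt e')" by auto
  define e2 where "e2 = map2 (+) e e'"
  have e2: "length e2 = Suc L" "wt e2 = wt e + wt e'" using e e' by (simp_all add: e2_def wt_add)
  have "(\<lambda>c. g c - a' * mon e' c) \<in> W L (Suc (wt e'))" using W_mono[OF g'] by simp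
  from W_add[OF this W_scale[OF W_mon[OF e'(1)], of _ a']]
  have gS: "g \<in> W L (Suc (wt e'))" by simp
  have "\<not> a * a' \<simeq> 0" using e e' by (simp add: mult_eqv_zero_iff)
  then obtain v where v: "a * a' * v \<simeq> 1" using inverse_ex by blast
  \<comment> \<open>The two lower-order remainders add up to \<open>f g - a a' mon e2\<close>. As
    \<open>f g\<close> vanishes, \<open>mon e2\<close> itself would have lower order.\<close>
  have "(\<lambda>c. g c * (f c - a * mon e c)) \<in> W L (wt e + wt e')"
    by (rule W_mult[OF gS f'])
  moreover have "(\<lambda>c. a * (mon e c * (g c - a' * mon e' c))) \<in> W L (wt e + wt e')"
    using W_scale[OF W_mon_mult[OF g' e(1)]] by (simp add: add.commute)
  ultimately have "(\<lambda>c. -(v * (g c * (f c - a * mon e c) + a * (mon e c * (g c - a' * mon e' c))))) \<in> W L (wt e2)"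
    using W_minus[OF W_scale[OF W_add]] e2(2) by auto
  then have mon_e2: "mon e2 \<in> W L (wt e2)"
  proof (rule W_cong)
    fix c assume c: "c \<in> pts L"
    have m: "mon e2 c = mon e c * mon e' c" unfolding e2_def using mon_add e(1) e'(1) by simp
    have "g c * (f c - a * mon e c) + a * (mon e c * (g c - a' * mon e' c)) = f c * g c - a * a' * mon e2 c"
      unfolding m by (simp add: algebra_simps)
    then have "-(v * (g c * (f c - a * mon e c) + a * (mon e c * (g c - a' * mon e' c))))
        = a * a' * v * mon e2 c - v * (f c * g c)" unfolding m by (simp add: algebra_simps)
    moreover have "a * a' * v * mon e2 c - v * (f c * g c) \<simeq> 1 * mon e2 c - 0"
      by (intro eqv_diff eqv_mult v eqv_refl eqv_mult_zero zero c)
    ultimately show "mon e2 c \<simeq> -(v * (g c * (f c - a * mon e c) + a * (mon e c * (g c - a' * mon e' c))))"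
      by (simp only: mult_1 diff_zero eqv_sym)
  qed
  from reduce[OF e2(1)] obtain r where r: "length r = Suc L" "reduced r" "wt r = wt e2"
    "(\<lambda>c. mon e2 c - mon r c) \<in> W L (wt e2)" by auto
  from W_diff[OF mon_e2 r(4)] have "mon r \<in> W L (wt r)" using r by simp
  moreover have "last r < q * q"
  proof (rule ccontr)
    assume "\<not> last r < q * q"
    then have "q * q * q ^ L \<le> last r * q ^ L" by (intro mult_right_mono) auto
    also have "\<dots> \<le> wt r" by (rule last_wt[OF r(1)])
    also have "\<dots> < q ^ (L + 2)" using r(3) e2(2) e(2) e'(2) assms(5) by simp
    finally show False by (simp add: power2_eq_square power_add)
  qed
  ultimately show False using mon_Red_not_W[of r L] r by (simp add: Red_def)
qed

lemma card_pts_last: "S \<subseteq> C \<Longrightarrow> card {c \<in> pts L. last c \<in> S} = card S * q ^ L"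
proof (induction L)
  case 0
  then have "{c \<in> pts 0. last c \<in> S} = (\<lambda>x. [x]) ` S" by auto
  then show ?case by (simp add: card_image inj_on_def)
next
  case (Suc L)
  have "{c \<in> pts (Suc L). last c \<in> S} = (\<lambda>(c, y). y # c) ` Sigma {c \<in> pts L. last c \<in> S} fibre"
    by (force split: if_splits)
  moreover have "inj_on (\<lambda>(c, y). y # c) (Sigma {c \<in> pts L. last c \<in> S} fibre)" by (auto simp: inj_on_def)
  ultimately show ?case using Suc by (simp add: card_image finite_pts finite_fibre card_fibre')
qed

text \<open>Multiplication by \<open>f\<close> sends the interpolants of all functions on
  \<open>J\<close>, the points over \<open>A\<close> base values, injectively to functions supported
  outside the zeros of \<open>f\<close>. So there are at least \<open>card J\<close> points that are
  not zeros.\<close>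

lemma card_zeros:
  assumes f: "f \<in> W L s" "\<exists>c\<in>pts L. \<not> f c \<simeq> 0"
    and A: "A \<le> q * q" "A * q ^ L + G L + s \<le> q ^ (L + 2) + 1"
  shows "card {c \<in> pts L. f c \<simeq> 0} + A * q ^ L \<le> q ^ (L + 2)"
proof -
  obtain S where S: "S \<subseteq> C" "card S = A" using A(1) card_C obtain_subset_with_card_n by metis
  define J where "J = {c \<in> pts L. last c \<in> S}"
  define Z where "Z = {c \<in> pts L. f c \<simeq> 0}"
  have "\<exists>g. g \<in> W L (A * q ^ L + G L) \<and> (\<forall>c\<in>J. g c \<simeq> h c)" for h
    using interpolate_W[of S A L h] S unfolding J_def by auto
  then obtain g where g: "\<And>h. g h \<in> W L (A * q ^ L + G L)" "\<And>h c. c \<in> J \<Longrightarrow> g h c \<simeq> h c"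
    by metis
  \<comment> \<open>The product vanishes on \<open>Z\<close>, so its values off \<open>Z\<close>
    determine it.\<close>
  define \<Phi> where "\<Phi> h = restrict (\<lambda>c. rep (f c * g h c)) (pts L - Z)" for h
  have "inj_on \<Phi> (J \<rightarrow>\<^sub>E C)"
  proof (rule inj_onI)
    fix h h' assume h: "h \<in> J \<rightarrow>\<^sub>E C" "h' \<in> J \<rightarrow>\<^sub>E C" "\<Phi> h = \<Phi> h'"
    have "f c * (g h c - g h' c) \<simeq> 0" if c: "c \<in> pts L" for c
    proof (cases "c \<in> Z")
      case True
      then show ?thesis using mult_eqv_zero_iff by (simp add: Z_def)
    next
      case False
      then have "\<Phi> h c = \<Phi> h' c" using h(3) by simp
      then show ?thesis using False c by (simp add: \<Phi>_def rep_eq_iff algebra_simps eqv_diff_zero[of "f c * g h c"])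
    qed
    then have "\<not> (\<exists>c\<in>pts L. \<not> g h c - g h' c \<simeq> 0)"
      using W_mult_nonzero[OF f W_diff[OF g(1)[of h] g(1)[of h']]] A(2) by (auto simp: add.commute)
    then have "g h c \<simeq> g h' c" if "c \<in> J" for c
      using that eqv_diff_zero by (auto simp: J_def)
    then have "h c \<simeq> h' c" if "c \<in> J" for c
      using that g(2) by (meson eqv_sym eqv_trans)
    then show "h = h'" using h by (intro PiE_ext[OF h(1,2)] C_eqv_imp_eq) auto
  qed
  moreover have "\<Phi> ` (J \<rightarrow>\<^sub>E C) \<subseteq> (pts L - Z) \<rightarrow>\<^sub>E C" unfolding \<Phi>_def by (intro image_subsetI PiE_I) (auto intro: rep)
  ultimately have "card (J \<rightarrow>\<^sub>E C) \<le> card ((pts L - Z) \<rightarrow>\<^sub>E C)"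
    by (intro card_inj_on_le) (auto intro!: finite_PiE simp: finite_pts finite_C)
  then have "(q * q) ^ card J \<le> (q * q) ^ card (pts L - Z)"
    by (simp add: card_PiE J_def finite_pts card_C)
  then have "card J \<le> card (pts L - Z)" using qq_gt_1 by (simp only: power_increasing_iff)
  moreover have "card (pts L - Z) = q ^ (L + 2) - card Z" "card Z \<le> q ^ (L + 2)"
    using card_mono[OF finite_pts[of L], of Z] card_Diff_subset[of Z "pts L"]
    by (auto simp: Z_def finite_pts card_pts)
  moreover have "card J = A * q ^ L" unfolding J_def using card_pts_last[OF S(1)] S(2) by simp
  ultimately show ?thesis unfolding Z_def by simp
qed

section \<open>Numerical bounds on pole orders\<close>

lemma Suc_power_le: "2 * i \<le> q \<Longrightarrow> (q + 1) ^ i \<le> 2 * q ^ i"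
proof -
  \<comment> \<open>The integer form of \<open>(1 + 1/q)^i \<le> q / (q - i)\<close>, where the
    right side is at most 2 if \<open>2 * i \<le> q\<close>.\<close>
  have *: "i \<le> q \<Longrightarrow> (q + 1) ^ i * (q - i) \<le> q ^ Suc i" for i
  proof (induction i)
    case (Suc i)
    then obtain k where k: "q = Suc i + k" using le_Suc_ex by blast
    have "(q + 1) * (q - Suc i) \<le> q * (q - i)" by (simp add: k algebra_simps)
    then have "(q + 1) ^ Suc i * (q - Suc i) \<le> (q + 1) ^ i * (q * (q - i))"
      by (simp only: power_Suc2 mult.assoc mult_le_mono2)
    also have "\<dots> = q * ((q + 1) ^ i * (q - i))" by (simp only: ac_simps)
    also have "\<dots> \<le> q * q ^ Suc i" using Suc by (intro mult_left_mono) auto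
    finally show ?case by simp
  qed simp
  assume i: "2 * i \<le> q"
  have "q * (q + 1) ^ i \<le> 2 * ((q - i) * (q + 1) ^ i)"
    unfolding mult.assoc[symmetric] by (intro mult_right_mono) (use i in auto)
  also have "\<dots> \<le> 2 * q ^ Suc i" using *[of i] i by (simp add: mult.commute)
  finally have "q * (q + 1) ^ i \<le> q * (2 * q ^ i)" by simp
  then show ?thesis using q_ge_2 by simp
qed

lemma G_le: "2 * L \<le> q \<Longrightarrow> G L \<le> 2 * L * q * q ^ L"
proof (induction L)
  case (Suc L)
  have "G (Suc L) \<le> q * (2 * L * q * q ^ L) + q * (2 * q ^ Suc L)"
    unfolding G.simps by (intro add_mono mult_mono Suc_power_le Suc.IH) (use Suc.prems in auto)
  then show ?case by (simp add: algebra_simps)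
qed simp

end

section \<open>Verifying inner products modulo a prime\<close>

definition bool_inner :: "nat \<Rightarrow> nat \<Rightarrow> (nat \<Rightarrow> nat \<Rightarrow> bool) \<Rightarrow> (nat \<Rightarrow> nat \<Rightarrow> bool) \<Rightarrow> nat" where
  "bool_inner J t X Y = (\<Sum>j<J. \<Sum>i<t. of_bool (X j i) * of_bool (Y j i))"

text \<open>
  One MA check modulo \<open>q\<close>: \<open>D\<close> possible proofs \<open>w\<close>, \<open>N\<close> evaluation points \<open>r\<close>, and \<open>J\<close> symbols
  below \<open>S\<close> from Bob, each depending on a single block of \<open>t\<close> bits of his input.
\<close>

definition gadget :: "nat \<Rightarrow> nat \<Rightarrow> nat \<Rightarrow> nat \<Rightarrow> nat \<Rightarrow> nat \<Rightarrow> ((nat \<Rightarrow> bool) \<Rightarrow> nat \<Rightarrow> nat) \<Rightarrow>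
    ((nat \<Rightarrow> nat \<Rightarrow> bool) \<Rightarrow> nat \<Rightarrow> nat \<Rightarrow> nat \<Rightarrow> nat list \<Rightarrow> bool) \<Rightarrow> bool" where
  "gadget q J t D S N enc acc \<longleftrightarrow>
     0 < N \<and> (\<forall>y r. enc y r < S) \<and>
     (\<forall>X Y v. [v = bool_inner J t X Y] (mod q) \<longrightarrow>
        (\<exists>w<D. \<forall>r<N. acc X v w r (map (\<lambda>j. enc (Y j) r) [0..<J]))) \<and>
     (\<forall>X Y v. \<not> [v = bool_inner J t X Y] (mod q) \<longrightarrow>
        (\<forall>w<D. 12 * card {r \<in> {..<N}. acc X v w r (map (\<lambda>j. enc (Y j) r) [0..<J])} \<le> N))"

context residue_field_sq
begin

section \<open>Arithmetic and size of the code space \<open>P\<close>\<close>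

lemma P_cong:
  assumes "f \<in> P L B s" "\<And>c. c \<in> pts (Suc L) \<Longrightarrow> g c \<simeq> f c"
  shows "g \<in> P L B s"
proof -
  from assms(1) obtain R where R: "\<And>b. b < B \<Longrightarrow> R b \<in> W L s"
    "\<And>c. c \<in> pts (Suc L) \<Longrightarrow> f c \<simeq> (\<Sum>b<B. hd c ^ b * R b (tl c))"
    unfolding P_def by blast
  show ?thesis unfolding P_def
    by (intro CollectI exI[of _ R] conjI allI ballI impI R(1) eqv_trans[OF assms(2) R(2)])
qed

lemma P_add:
  assumes "f \<in> P L B s" "g \<in> P L B s"
  shows "(\<lambda>c. f c + g c) \<in> P L B s"
proof -
  from assms(1) obtain R where R: "\<And>b. b < B \<Longrightarrow> R b \<in> W L s"
    "\<And>c. c \<in> pts (Suc L) \<Longrightarrow> f c \<simeq> (\<Sum>b<B. hd c ^ b * R b (tl c))"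
    unfolding P_def by blast
  from assms(2) obtain R' where R': "\<And>b. b < B \<Longrightarrow> R' b \<in> W L s"
    "\<And>c. c \<in> pts (Suc L) \<Longrightarrow> g c \<simeq> (\<Sum>b<B. hd c ^ b * R' b (tl c))"
    unfolding P_def by blast
  have "f c + g c \<simeq> (\<Sum>b<B. hd c ^ b * (R b (tl c) + R' b (tl c)))" if "c \<in> pts (Suc L)" for c
    using eqv_add[OF R(2) R'(2), OF that that] by (simp only: distrib_left sum.distrib)
  then show ?thesis unfolding P_def
    by (intro CollectI exI[of _ "\<lambda>b c. R b c + R' b c"] conjI allI ballI impI W_add R(1) R'(1)) auto
qed

lemma P_term:
  assumes "R \<in> W L s" "b < B"
  shows "(\<lambda>c. hd c ^ b * R (tl c)) \<in> P L B s"
proof -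
  have *: "(\<Sum>i<B. x ^ i * (if i = b then R else (\<lambda>_. 0)) c) = x ^ b * R c" for x c
  proof -
    have "(\<Sum>i<B. x ^ i * (if i = b then R else (\<lambda>_. 0)) c) = (\<Sum>i<B. if i = b then x ^ b * R c else 0)"
      by (intro sum.cong) auto
    then show ?thesis using assms(2) by (simp add: sum.delta)
  qed
  have "(if i = b then R else (\<lambda>_. 0)) \<in> W L s" for i
    using assms(1) W_zero[of L "\<lambda>_. 0" s] by simp
  then show ?thesis unfolding P_def
    by (intro CollectI exI[of _ "\<lambda>i. if i = b then R else (\<lambda>_. 0)"]) (simp only: * eqv_refl, simp)
qed

lemma P_sum:
  assumes "\<And>i. i \<in> S \<Longrightarrow> f i \<in> P L B s" "0 < B"
  shows "(\<lambda>c. \<Sum>i\<in>S. f i c) \<in> P L B s"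
proof -
  have "(\<lambda>_. 0) \<in> P L B s"
    using P_term[OF W_zero[of L "\<lambda>_. 0" s] assms(2)] by simp
  then show ?thesis using assms(1)
    by (induction S rule: infinite_finite_induct) (auto intro: P_add)
qed

lemma P_scale:
  assumes "f \<in> P L B s"
  shows "(\<lambda>c. a * f c) \<in> P L B s"
proof -
  from assms(1) obtain R where R: "\<And>b. b < B \<Longrightarrow> R b \<in> W L s"
    "\<And>c. c \<in> pts (Suc L) \<Longrightarrow> f c \<simeq> (\<Sum>b<B. hd c ^ b * R b (tl c))"
    unfolding P_def by blast
  have "a * f c \<simeq> (\<Sum>b<B. hd c ^ b * (a * R b (tl c)))" if "c \<in> pts (Suc L)" for c
    using eqv_mult[OF eqv_refl[of a] R(2)[OF that]] by (simp only: sum_distrib_left mult.left_commute)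
  then show ?thesis unfolding P_def
    by (intro CollectI exI[of _ "\<lambda>b c. a * R b c"] conjI allI ballI impI W_scale R(1)) auto
qed

lemma P_diff: "f \<in> P L B s \<Longrightarrow> g \<in> P L B s \<Longrightarrow> (\<lambda>c. f c - g c) \<in> P L B s"
  using P_add[OF _ P_scale[of g L B s "-1"]] by simp

text \<open>Two exponents of the newest coordinate below \<open>B\<close> add up to less than
  \<open>2 * B\<close>; no reduction by the tower equation takes place.\<close>

lemma P_mult:
  assumes "f \<in> P L B s" "g \<in> P L B s'"
  shows "(\<lambda>c. f c * g c) \<in> P L (2 * B) (s + s')"
proof (cases "B = 0")
  case True
  then have "f c \<simeq> 0" if "c \<in> pts (Suc L)" for c
    using that assms(1) unfolding P_def by force
  then show ?thesis using True unfolding P_def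
    by (simp add: mult_eqv_zero_iff del: pts.simps)
next
  case False
  from assms(1) obtain R where R: "\<And>b. b < B \<Longrightarrow> R b \<in> W L s"
    "\<And>c. c \<in> pts (Suc L) \<Longrightarrow> f c \<simeq> (\<Sum>b<B. hd c ^ b * R b (tl c))"
    unfolding P_def by blast
  from assms(2) obtain R' where R': "\<And>b. b < B \<Longrightarrow> R' b \<in> W L s'"
    "\<And>c. c \<in> pts (Suc L) \<Longrightarrow> g c \<simeq> (\<Sum>b<B. hd c ^ b * R' b (tl c))"
    unfolding P_def by blast
  have "(\<lambda>c. R i c * R' j c) \<in> W L (s + s')" if "i < B" "j < B" for i j
    using W_mult[OF W_mono[OF R(1)] R'(1), OF that(1) _ that(2), of s] by (simp add: add.commute)
  then have "(\<lambda>c. hd c ^ (i + j) * (R i (tl c) * R' j (tl c))) \<in> P L (2 * B) (s + s')" if "i < B" "j < B" for i j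
    using P_term[of "\<lambda>c. R i c * R' j c" L "s + s'" "i + j" "2 * B"] that by simp
  then have "(\<lambda>c. \<Sum>i<B. \<Sum>j<B. hd c ^ (i + j) * (R i (tl c) * R' j (tl c))) \<in> P L (2 * B) (s + s')"
    using False by (intro P_sum) auto
  then show ?thesis
  proof (rule P_cong)
    fix c assume "c \<in> pts (Suc L)"
    from eqv_mult[OF R(2) R'(2), OF this this]
    show "f c * g c \<simeq> (\<Sum>i<B. \<Sum>j<B. hd c ^ (i + j) * (R i (tl c) * R' j (tl c)))"
      unfolding sum_product power_add by (simp only: ac_simps)
  qed
qed

definition Pc :: "nat \<Rightarrow> nat \<Rightarrow> nat \<Rightarrow> ('a list \<Rightarrow> 'a) set"
  where "Pc L B s = P L B s \<inter> (pts (Suc L) \<rightarrow>\<^sub>E C)"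

lemma finite_Pc: "finite (Pc L B s)"
  unfolding Pc_def by (intro finite_Int disjI2 finite_PiE finite_pts finite_C)

lemma canon_Pc:
  assumes "f \<in> P L B s"
  shows "canon (Suc L) f \<in> Pc L B s"
  unfolding Pc_def by (intro IntI P_cong[OF assms] canon_eqv canon_PiE)

text \<open>A function is determined by its \<open>B\<close> coefficients, each with at most
  \<open>(q * q) ^ s\<close> normal forms.\<close>

lemma card_Pc: "card (Pc L B s) \<le> (q * q) ^ (s * B)"
proof -
  have "Pc L B s \<subseteq> (\<lambda>R. canon (Suc L) (\<lambda>c. \<Sum>b<B. hd c ^ b * R b (tl c))) ` ({..<B} \<rightarrow>\<^sub>E Wc L s)"
  proof
    fix f assume f: "f \<in> Pc L B s"
    then have "f \<in> P L B s" by (simp add: Pc_def)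
    then obtain R where R: "\<And>b. b < B \<Longrightarrow> R b \<in> W L s"
      "\<And>c. c \<in> pts (Suc L) \<Longrightarrow> f c \<simeq> (\<Sum>b<B. hd c ^ b * R b (tl c))"
      unfolding P_def by blast
    define R' where "R' = restrict (\<lambda>b. canon L (R b)) {..<B}"
    have "R' \<in> {..<B} \<rightarrow>\<^sub>E Wc L s" using R(1) by (auto simp: R'_def canon_Wc)
    moreover have "f = canon (Suc L) (\<lambda>c. \<Sum>b<B. hd c ^ b * R' b (tl c))"
    proof (rule canon_eqI[symmetric])
      show "f \<in> pts (Suc L) \<rightarrow>\<^sub>E C" using f by (simp add: Pc_def)
      fix c assume c: "c \<in> pts (Suc L)"
      then have tl: "tl c \<in> pts L" by auto
      have "(\<Sum>b<B. hd c ^ b * R b (tl c)) \<simeq> (\<Sum>b<B. hd c ^ b * R' b (tl c))"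
        by (intro eqv_sum eqv_mult eqv_refl) (simp add: R'_def eqv_sym[OF canon_eqv[OF tl]])
      with R(2)[OF c] show "f c \<simeq> (\<Sum>b<B. hd c ^ b * R' b (tl c))" by (rule eqv_trans)
    qed
    ultimately show "f \<in> (\<lambda>R. canon (Suc L) (\<lambda>c. \<Sum>b<B. hd c ^ b * R b (tl c))) ` ({..<B} \<rightarrow>\<^sub>E Wc L s)"
      by blast
  qed
  from surj_card_le[OF _ this] have "card (Pc L B s) \<le> card (Wc L s) ^ B"
    by (simp add: card_PiE finite_PiE finite_Wc)
  also have "\<dots> \<le> ((q * q) ^ s) ^ B" by (intro power_mono card_Wc_le_power) simp
  finally show ?thesis by (simp only: power_mult)
qed

section \<open>From the code to one check modulo a prime\<close>

lemma of_nat_eqv_iff: "of_nat a \<simeq> of_nat b \<longleftrightarrow> [a = b] (mod q)"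
proof -
  have *: "of_nat a \<simeq> of_nat b \<longleftrightarrow> [a = b] (mod q)" if "b \<le> a" for a b
    using of_nat_I[of "a - b"] that by (simp add: eqv_def of_nat_diff cong_altdef_nat)
  show ?thesis using *[of a b] *[of b a] by (meson cong_sym eqv_sym linear)
qed

text \<open>Parameters: \<open>A\<close> values of \<open>x\<^sub>0\<close>, all chains above them up to level \<open>L\<close>, and \<open>B\<close> points of each
  fibre of level \<open>Suc L\<close> form the information set of the code.\<close>

lemma code_exists:
  fixes lam L B t :: nat
  assumes lam: "L < lam" "168 * lam \<le> q" and B: "0 < B" "B \<le> q"
    and t: "t \<le> 2 * lam * q * q ^ L * B"
  defines "s \<equiv> 4 * lam * q * q ^ L"
  shows "\<exists>pos. (\<forall>i<t. pos i \<in> pts (Suc L)) \<and>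
    (\<forall>z. \<exists>f\<in>P L B s. \<forall>i<t. f (pos i) \<simeq> z i)"
proof -
  define A where "A = 2 * lam * q"
  have "A \<le> card C" unfolding A_def card_C using lam by (intro mult_right_mono) auto
  then obtain S where S: "S \<subseteq> C" "card S = A" using obtain_subset_with_card_n by metis
  have "\<exists>F. F \<subseteq> fibre c \<and> card F = B" for c
    using B(2) card_fibre'[of c] obtain_subset_with_card_n by metis
  then obtain F where F: "\<And>c. F c \<subseteq> fibre c" "\<And>c. card (F c) = B" by metis
  have finF: "finite (F c)" for c using F(1) finite_fibre finite_subset by blast
  define J where "J = (\<lambda>(c, y). y # c) ` Sigma {c \<in> pts L. last c \<in> S} F"
  have "inj_on (\<lambda>(c, y). y # c) (Sigma {c \<in> pts L. last c \<in> S} F)" by (auto simp: inj_on_def)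
  then have "card J = A * q ^ L * B"
    by (simp add: J_def card_image finite_pts finF F card_pts_last[OF S(1)] S(2))
  with t have "t \<le> card J" by (simp add: A_def)
  moreover have "finite J" by (simp add: J_def finite_pts finF)
  ultimately obtain J' where J': "J' \<subseteq> J" "card J' = t" "finite J'"
    using obtain_subset_with_card_n by metis
  obtain pos where pos: "bij_betw pos {..<t} J'"
    using ex_bij_betw_nat_finite[OF J'(3)] J'(2) by (auto simp: lessThan_atLeast0)
  have posJ: "pos i \<in> J" if "i < t" for i using pos J'(1) that by (auto simp: bij_betw_def)
  have J: "J \<subseteq> pts (Suc L)" using F(1) unfolding J_def pts.simps by (intro image_mono Sigma_mono) auto
  have "\<exists>f\<in>P L B s. \<forall>i<t. f (pos i) \<simeq> z i" for z
  proof -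
    define h where "h c = z (inv_into {..<t} pos c)" for c
    have "\<exists>f\<in>P L B (A * q ^ L + G L). \<forall>c\<in>pts L. \<forall>y\<in>F c. last c \<in> S \<longrightarrow> y # c \<in> pts (Suc L) \<longrightarrow> f (y # c) \<simeq> h (y # c)"
    proof (rule interpolate_P)
      show "\<exists>f\<in>W L (A * q ^ L + G L). \<forall>c\<in>pts L. last c \<in> S \<longrightarrow> f c \<simeq> h c" for h
        by (rule interpolate_W) (use S in auto)
      show "F c \<subseteq> C \<and> card (F c) \<le> B" for c using F fibre_C by (metis order_refl order_trans)
    qed
    then obtain f where f: "f \<in> P L B (A * q ^ L + G L)" "\<forall>c\<in>J. f c \<simeq> h c"
      using J unfolding J_def by fastforce
    \<comment> \<open>The interpolants have order below \<open>A * q ^ L + G L\<close>;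
      \<open>s\<close> is \<open>2 * A * q ^ L\<close>, which leaves room for
      \<open>G L\<close>.\<close>
    have "G L \<le> 2 * L * q * q ^ L" by (rule G_le) (use lam in simp)
    also have "\<dots> \<le> A * q ^ L" unfolding A_def by (intro mult_right_mono) (use lam in auto)
    finally have "A * q ^ L + G L \<le> s" by (simp add: A_def s_def)
    then have "f \<in> P L B s" using f(1) W_mono unfolding P_def mem_Collect_eq by meson
    moreover have "f (pos i) \<simeq> z i" if "i < t" for i
      using f(2) posJ[OF that] pos that by (auto simp: h_def bij_betw_def)
    ultimately show ?thesis by blast
  qed
  with posJ J show ?thesis by blast
qed

text \<open>Two candidates for the sum of products differ by such an \<open>f\<close>, so they agree
  on at most 1/12 of the points. The constant 168 is \<open>12 * 14\<close>: the fraction of zeros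
  is at most \<open>14 * lam / q\<close>.\<close>

lemma code_zeros:
  fixes lam L B :: nat
  assumes lam: "L < lam" "168 * lam \<le> q" and B: "0 < B" "B \<le> q"
  defines "s \<equiv> 4 * lam * q * q ^ L"
  assumes f: "f \<in> P L (2 * B) (s + s)" "\<exists>c\<in>pts (Suc L). \<not> f c \<simeq> 0"
  shows "12 * card {c \<in> pts (Suc L). f c \<simeq> 0} \<le> card (pts (Suc L))"
proof -
  define A where "A = 2 * lam * q"
  have A: "5 * A + 4 * q \<le> 14 * lam * q" using lam by (simp add: A_def)
  have "14 * lam * q \<le> q * q" "12 * (14 * lam * q) \<le> q * q"
    unfolding mult.assoc[symmetric] by (intro mult_right_mono; use lam in simp)+
  note A2 = this
  \<comment> \<open>Of the \<open>q * q\<close> base values, the order of \<open>f\<close> uses up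
    \<open>4 * A + 4 * q\<close> and \<open>G (Suc L)\<close> at most \<open>A\<close>. The
    remaining \<open>A'\<close> values count non-zeros in \<open>card_zeros\<close>.\<close>
  obtain A' where A': "q * q = 5 * A + 4 * q + A'" using A A2(1) le_Suc_ex by (metis order_trans)
  have "(q + 1) ^ Suc L \<le> 2 * q ^ Suc L" by (rule Suc_power_le) (use lam in simp)
  note pw = this
  have W: "f \<in> W (Suc L) ((4 * A + 4 * q) * q ^ Suc L)"
  proof (rule P_subset_W[OF f(1)])
    fix w b assume "w < s + s" "b < 2 * B"
    then have "q * w < q * (s + s)" "b \<le> 2 * q" using B q_ge_2 by auto
    then have "q * w + b * (q + 1) ^ Suc L < q * (s + s) + 2 * q * (2 * q ^ Suc L)"
      using pw by (intro add_less_le_mono mult_mono) auto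
    also have "\<dots> = (4 * A + 4 * q) * q ^ Suc L" by (simp add: s_def A_def algebra_simps)
    finally show "q * w + b * (q + 1) ^ Suc L < (4 * A + 4 * q) * q ^ Suc L" .
  qed
  have "G (Suc L) \<le> 2 * Suc L * q * q ^ Suc L" by (rule G_le) (use lam in simp)
  also have "\<dots> \<le> A * q ^ Suc L" unfolding A_def by (intro mult_right_mono) (use lam in auto)
  finally have G: "G (Suc L) \<le> A * q ^ Suc L" .
  have N: "q ^ (Suc L + 2) = (5 * A + 4 * q + A') * q ^ Suc L"
    by (simp add: A'[symmetric])
  have "card {c \<in> pts (Suc L). f c \<simeq> 0} + A' * q ^ Suc L \<le> q ^ (Suc L + 2)"
  proof (rule card_zeros[OF W f(2)])
    show "A' \<le> q * q" using A' by simp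
    have "A' * q ^ Suc L + G (Suc L) + (4 * A + 4 * q) * q ^ Suc L
        \<le> A' * q ^ Suc L + A * q ^ Suc L + (4 * A + 4 * q) * q ^ Suc L"
      using G by simp
    also have "\<dots> = q ^ (Suc L + 2)" unfolding N by (simp only: distrib_right[symmetric]) simp
    finally show "A' * q ^ Suc L + G (Suc L) + (4 * A + 4 * q) * q ^ Suc L \<le> q ^ (Suc L + 2) + 1" by simp
  qed
  then have "card {c \<in> pts (Suc L). f c \<simeq> 0} \<le> (5 * A + 4 * q) * q ^ Suc L"
    unfolding N by (simp only: distrib_right)
  also have "\<dots> \<le> (14 * lam * q) * q ^ Suc L" by (intro mult_right_mono A) simp
  finally have "12 * card {c \<in> pts (Suc L). f c \<simeq> 0} \<le> (12 * (14 * lam * q)) * q ^ Suc L" by simp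
  also have "\<dots> \<le> (q * q) * q ^ Suc L" by (intro mult_right_mono A2) simp
  finally show ?thesis by (simp only: card_pts) simp
qed

text \<open>If the claim is wrong, a proof function with the claimed sum over the positions differs
  from the true \<open>R\<close>, so by \<open>code_zeros\<close> a random point exposes it with
  probability at least 11/12.\<close>

lemma gadget_exists:
  fixes lam L B t J :: nat
  assumes lam: "L < lam" "168 * lam \<le> q" and B: "0 < B" "B \<le> q"
    and t: "t \<le> 2 * lam * q * q ^ L * B"
    and D: "q ^ (32 * lam * q * q ^ L * B) \<le> D" and S: "q * q \<le> S"
  shows "\<exists>N enc acc. gadget q J t D S N enc acc"
proof -
  define s where "s = 4 * lam * q * q ^ L"
  obtain pos where pos: "\<And>i. i < t \<Longrightarrow> pos i \<in> pts (Suc L)"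
    and ex: "\<And>z. \<exists>f\<in>P L B s. \<forall>i<t. f (pos i) \<simeq> z i"
    using code_exists[OF lam B t] unfolding s_def by blast
  have "\<exists>f. f \<in> P L B s \<and> (\<forall>i<t. f (pos i) \<simeq> of_bool (z i))" for z
    using ex[of "\<lambda>i. of_bool (z i)"] by blast
  then obtain E where E: "\<And>z. E z \<in> P L B s" "\<And>z i. i < t \<Longrightarrow> E z (pos i) \<simeq> of_bool (z i)"
    by metis
  define N where "N = card (pts (Suc L))"
  \<comment> \<open>Field elements, points and possible proof functions are numbered by
    \<open>\<beta>\<close>, \<open>\<pi>\<close> and \<open>\<omega>\<close>, so that messages,
    coins and advice become natural numbers.\<close>
  obtain \<beta> where \<beta>: "bij_betw \<beta> C {..<q * q}"
    using ex_bij_betw_finite_nat[OF finite_C] card_C by (auto simp: lessThan_atLeast0)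
  obtain \<pi> where \<pi>: "bij_betw \<pi> {..<N} (pts (Suc L))"
    using ex_bij_betw_nat_finite[OF finite_pts] unfolding N_def lessThan_atLeast0 by blast
  define D0 where "D0 = card (Pc L (2 * B) (s + s))"
  obtain \<omega> where \<omega>: "bij_betw \<omega> {..<D0} (Pc L (2 * B) (s + s))"
    using ex_bij_betw_nat_finite[OF finite_Pc] unfolding D0_def lessThan_atLeast0 by blast
  define enc where "enc y r = \<beta> (rep (E y (\<pi> r)))" for y r
  \<comment> \<open>Three tests: the proof index is valid, the proof function has the claimed sum
    over the positions, and it agrees at the random point with the sum that Bob's symbols
    yield.\<close>
  define acc where "acc X v w r m \<longleftrightarrow> w < D0 \<and> (\<Sum>i<t. \<omega> w (pos i)) \<simeq> of_nat v \<and>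
    \<omega> w (\<pi> r) \<simeq> (\<Sum>j<J. E (X j) (\<pi> r) * inv_into C \<beta> (m ! j))" for X v w r m
  have \<beta>_inv: "inv_into C \<beta> (enc y r) = rep (E y (\<pi> r))" for y r
    unfolding enc_def using \<beta> rep(1) by (metis bij_betw_inv_into_left)
  define R where "R X Y c = (\<Sum>j<J. E (X j) c * E (Y j) c)" for X Y c
  have RP: "R X Y \<in> P L (2 * B) (s + s)" for X Y
    unfolding R_def using B(1) by (intro P_sum P_mult E) auto
  have R_inner: "(\<Sum>i<t. R X Y (pos i)) \<simeq> of_nat (bool_inner J t X Y)" for X Y
  proof -
    have "(\<Sum>i<t. R X Y (pos i)) \<simeq> (\<Sum>i<t. \<Sum>j<J. of_bool (X j i) * of_bool (Y j i))"
      unfolding R_def by (intro eqv_sum eqv_mult E) auto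
    also have "\<dots> = of_nat (bool_inner J t X Y)"
      unfolding bool_inner_def of_nat_sum of_nat_mult of_nat_of_bool by (rule sum.swap)
    finally show ?thesis .
  qed
  have acc_iff: "acc X v w r (map (\<lambda>j. enc (Y j) r) [0..<J]) \<longleftrightarrow>
      w < D0 \<and> (\<Sum>i<t. \<omega> w (pos i)) \<simeq> of_nat v \<and> \<omega> w (\<pi> r) \<simeq> R X Y (\<pi> r)" for X Y v w r
  proof -
    have "(\<Sum>j<J. E (X j) (\<pi> r) * inv_into C \<beta> (map (\<lambda>j. enc (Y j) r) [0..<J] ! j)) =
        (\<Sum>j<J. E (X j) (\<pi> r) * rep (E (Y j) (\<pi> r)))"
      by (intro sum.cong) (auto simp: \<beta>_inv)
    also have "\<dots> \<simeq> R X Y (\<pi> r)"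
      unfolding R_def by (intro eqv_sum eqv_mult eqv_refl eqv_sym[OF rep(2)])
    finally show ?thesis unfolding acc_def by (meson eqv_sym eqv_trans)
  qed
  have "pts (Suc L) \<noteq> {}" using card_pts[of "Suc L"] q_ge_2 by (metis card.empty power_eq_0_iff not_numeral_le_zero)
  then have "0 < N" using finite_pts[of "Suc L"] by (simp add: N_def card_gt_0_iff del: pts.simps)
  moreover have "enc y r < q * q" for y r
    using \<beta> rep(1) by (auto simp: enc_def bij_betw_def)
  then have "enc y r < S" for y r using S by (rule less_le_trans)
  moreover have "D0 \<le> D"
  proof -
    have "D0 \<le> (q * q) ^ ((s + s) * (2 * B))" unfolding D0_def by (rule card_Pc)
    also have "\<dots> = q ^ (2 * ((s + s) * (2 * B)))" by (simp only: power_mult power2_eq_square)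
    also have "2 * ((s + s) * (2 * B)) = 32 * lam * q * q ^ L * B" by (simp add: s_def)
    also note D
    finally show ?thesis .
  qed
  moreover have "\<exists>w<D0. \<forall>r<N. acc X v w r (map (\<lambda>j. enc (Y j) r) [0..<J])" if "[v = bool_inner J t X Y] (mod q)" for X Y v
  proof -
    have "canon (Suc L) (R X Y) \<in> Pc L (2 * B) (s + s)" by (rule canon_Pc[OF RP])
    then obtain w where w: "w < D0" "\<omega> w = canon (Suc L) (R X Y)"
      using \<omega> by (metis bij_betw_iff_bijections lessThan_iff)
    have "(\<Sum>i<t. \<omega> w (pos i)) \<simeq> (\<Sum>i<t. R X Y (pos i))"
      unfolding w(2) by (intro eqv_sum canon_eqv pos) simp
    also note R_inner
    also have "of_nat (bool_inner J t X Y) \<simeq> of_nat v" using that by (simp add: of_nat_eqv_iff cong_sym)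
    finally have "(\<Sum>i<t. \<omega> w (pos i)) \<simeq> of_nat v" .
    moreover have "\<omega> w (\<pi> r) \<simeq> R X Y (\<pi> r)" if "r < N" for r
      unfolding w(2) using \<pi> that by (intro canon_eqv) (auto simp: bij_betw_def)
    ultimately show ?thesis using w(1) acc_iff by blast
  qed
  moreover have "12 * card {r \<in> {..<N}. acc X v w r (map (\<lambda>j. enc (Y j) r) [0..<J])} \<le> N"
    if v: "\<not> [v = bool_inner J t X Y] (mod q)" for X Y v w
  proof (cases "w < D0 \<and> (\<Sum>i<t. \<omega> w (pos i)) \<simeq> of_nat v")
    case False
    then have "{r \<in> {..<N}. acc X v w r (map (\<lambda>j. enc (Y j) r) [0..<J])} = {}" using acc_iff by blast
    then show ?thesis by (simp only: card.empty)
  next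
    case True
    then have wP: "\<omega> w \<in> P L (2 * B) (s + s)" using \<omega> by (auto simp: bij_betw_def Pc_def)
    define f where "f c = \<omega> w c - R X Y c" for c
    have fP: "f \<in> P L (2 * B) (s + s)" unfolding f_def by (rule P_diff[OF wP RP])
    have nz: "\<exists>c\<in>pts (Suc L). \<not> f c \<simeq> 0"
    proof (rule ccontr)
      assume "\<not> ?thesis"
      then have eq: "\<omega> w c \<simeq> R X Y c" if "c \<in> pts (Suc L)" for c
        using that eqv_diff_zero unfolding f_def by blast
      have "of_nat v \<simeq> (\<Sum>i<t. \<omega> w (pos i))" using True eqv_sym by blast
      also have "\<dots> \<simeq> (\<Sum>i<t. R X Y (pos i))" by (intro eqv_sum eq pos) simp
      also note R_inner
      finally show False using v by (simp add: of_nat_eqv_iff)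
    qed
    have "\<pi> ` {r \<in> {..<N}. acc X v w r (map (\<lambda>j. enc (Y j) r) [0..<J])} \<subseteq> {c \<in> pts (Suc L). f c \<simeq> 0}"
    proof
      fix c assume "c \<in> \<pi> ` {r \<in> {..<N}. acc X v w r (map (\<lambda>j. enc (Y j) r) [0..<J])}"
      then obtain r where r: "c = \<pi> r" "r < N" "\<omega> w (\<pi> r) \<simeq> R X Y (\<pi> r)" using acc_iff by blast
      then show "c \<in> {c \<in> pts (Suc L). f c \<simeq> 0}"
        using \<pi> eqv_diff_zero unfolding f_def bij_betw_def by blast
    qed
    moreover have "inj_on \<pi> {r \<in> {..<N}. acc X v w r (map (\<lambda>j. enc (Y j) r) [0..<J])}"
      using \<pi> by (auto simp: bij_betw_def intro: inj_on_subset)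
    ultimately have "card {r \<in> {..<N}. acc X v w r (map (\<lambda>j. enc (Y j) r) [0..<J])} \<le> card {c \<in> pts (Suc L). f c \<simeq> 0}"
      using finite_pts by (intro card_inj_on_le[of \<pi>]) (simp_all del: pts.simps)
    moreover have "12 * card {c \<in> pts (Suc L). f c \<simeq> 0} \<le> N"
      unfolding N_def by (rule code_zeros[OF lam B]) (use fP nz in \<open>simp_all add: s_def\<close>)
    ultimately show ?thesis by linarith
  qed
  ultimately have "gadget q J t D S N enc acc"
    unfolding gadget_def by (meson less_le_trans)
  then show ?thesis by blast
qed

end

section \<open>The field with \<open>p\<^sup>2\<close> elements\<close>

text \<open>\<open>quad d f\<close> are the coordinates of \<open>f(\<surd>d)\<close> with respect to the basis \<open>1, \<surd>d\<close>.\<close>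

definition quad :: "int \<Rightarrow> int poly \<Rightarrow> int \<times> int" where
  "quad d f = fold_coeffs (\<lambda>a (u, v). (a + d * v, u)) f (0, 0)"

lemma quad_0 [simp]: "quad d 0 = (0, 0)"
  by (simp add: quad_def)

lemma quad_pCons [simp]: "quad d (pCons a f) = (a + d * snd (quad d f), fst (quad d f))"
proof -
  have "fold_coeffs (\<lambda>a (u, v). (a + d * v, u)) (pCons a f) (0, 0)
      = (\<lambda>a (u, v). (a + d * v, u)) a (fold_coeffs (\<lambda>a (u, v). (a + d * v, u)) f (0, 0))"
    by (cases "f = 0"; cases "a = 0") auto
  then show ?thesis by (simp add: quad_def split: prod.splits)
qed

lemma quad_add:
  "quad d (f + g) = (fst (quad d f) + fst (quad d g), snd (quad d f) + snd (quad d g))"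
  by (induction f g rule: poly_induct2) (simp_all add: algebra_simps)

lemma quad_smult: "quad d (Polynomial.smult a f) = (a * fst (quad d f), a * snd (quad d f))"
  by (induction f) (simp_all add: algebra_simps)

lemma quad_minus: "quad d (- f) = (- fst (quad d f), - snd (quad d f))"
  using quad_smult[of d "-1" f] by simp

lemma quad_diff:
  "quad d (f - g) = (fst (quad d f) - fst (quad d g), snd (quad d f) - snd (quad d g))"
  using quad_add[of d f "- g"] by (simp add: quad_minus)

lemma quad_mult:
  "quad d (f * g) = (fst (quad d f) * fst (quad d g) + d * (snd (quad d f) * snd (quad d g)),
     fst (quad d f) * snd (quad d g) + snd (quad d f) * fst (quad d g))"
  by (induction f) (simp_all add: quad_add quad_smult algebra_simps)

text \<open>The ideal generated by \<open>p\<close> and \<open>X^2 - d\<close>. For a prime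
  \<open>p\<close> and a nonresidue \<open>d\<close> the quotient has \<open>p^2\<close> elements
  and is a field.\<close>

definition quad_ideal :: "nat \<Rightarrow> int \<Rightarrow> int poly set" where
  "quad_ideal p d = {f. int p dvd fst (quad d f) \<and> int p dvd snd (quad d f)}"

definition quad_reps :: "nat \<Rightarrow> int poly set" where
  "quad_reps p = (\<lambda>(a, b). [:a, b:]) ` ({0..<int p} \<times> {0..<int p})"

lemma ideal_congruence_quad: "ideal_congruence (quad_ideal p d)"
  by unfold_locales
     (auto simp: quad_ideal_def quad_add quad_mult intro!: dvd_add dvd_mult)

text \<open>Squaring modulo \<open>p\<close> identifies 1 and \<open>p - 1\<close>, so on a finite
  set it cannot be surjective.\<close>

lemma nonresidue_ex:
  assumes "2 < (p::nat)"
  shows "\<exists>d::int. \<forall>y. \<not> [y\<^sup>2 = d] (mod int p)"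
proof -
  define f where "f y = y\<^sup>2 mod int p" for y
  have "f 1 = f (int p - 1)"
  proof -
    have "(int p - 1)\<^sup>2 - 1\<^sup>2 = int p * (int p - 2)" by (simp add: power2_eq_square algebra_simps)
    then have "[(int p - 1)\<^sup>2 = 1\<^sup>2] (mod int p)" unfolding cong_iff_dvd_diff by (metis dvd_triv_left)
    then show ?thesis by (simp add: f_def cong_def)
  qed
  then have "\<not> inj_on f {0..<int p}" using assms by (auto dest: inj_onD[of f _ 1 "int p - 1"])
  then have "f ` {0..<int p} \<noteq> {0..<int p}" using finite_surj_inj[of "{0..<int p}" f] by auto
  moreover have "f ` {0..<int p} \<subseteq> {0..<int p}" using assms by (auto simp: f_def)
  ultimately obtain d where d: "d \<in> {0..<int p}" "d \<notin> f ` {0..<int p}" by blast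
  have "\<not> [y\<^sup>2 = d] (mod int p)" for y
  proof
    assume "[y\<^sup>2 = d] (mod int p)"
    then have "f (y mod int p) = d" using d(1) by (simp add: f_def cong_def power_mod)
    then show False using d(2) assms by (auto simp: image_iff)
  qed
  then show ?thesis by blast
qed

section \<open>Frobenius map, trace and norm\<close>

locale quad_field = ideal_congruence "quad_ideal p d" for p :: nat and d :: int +
  assumes prime_p: "prime p" and odd_p: "2 < p"
    and nonresidue: "\<And>y. \<not> [y\<^sup>2 = d] (mod int p)"
begin

notation eqv (infix "\<simeq>" 50)

abbreviation "U f \<equiv> fst (quad d f)"
abbreviation "V f \<equiv> snd (quad d f)"

lemma prime_int_p: "prime (int p)"
  using prime_p by simp

lemma eqv_quad: "f \<simeq> g \<longleftrightarrow> int p dvd U f - U g \<and> int p dvd V f - V g"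
  unfolding eqv_def by (simp add: quad_ideal_def quad_diff)

lemma p_eqv_0: "of_nat p * f \<simeq> 0"
proof -
  have "of_nat p * f = Polynomial.smult (int p) f" by (simp add: of_nat_poly)
  then show ?thesis by (simp add: eqv_quad quad_smult)
qed

lemma frobenius_add: "(f + g) ^ p \<simeq> f ^ p + g ^ p"
proof -
  have "(f + g) ^ p = (\<Sum>k\<le>p. of_nat (p choose k) * f ^ k * g ^ (p - k))" by (rule binomial_ring)
  also have "\<dots> \<simeq> (\<Sum>k\<le>p. (if k = 0 then g ^ p else 0) + (if k = p then f ^ p else 0))"
  proof (rule eqv_sum)
    fix k assume "k \<in> {..p}"
    show "of_nat (p choose k) * f ^ k * g ^ (p - k) \<simeq> (if k = 0 then g ^ p else 0) + (if k = p then f ^ p else 0)"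
    proof (cases "k = 0 \<or> k = p")
      case True
      then show ?thesis using odd_p by auto
    next
      case False
      then have "p dvd p choose k" using \<open>k \<in> {..p}\<close> prime_p by (intro dvd_choose_prime) auto
      then obtain m where m: "p choose k = p * m" by auto
      show ?thesis using p_eqv_0[of "of_nat m * f ^ k * g ^ (p - k)"] False
        by (simp add: m mult.assoc)
    qed
  qed
  also have "\<dots> = f ^ p + g ^ p" using odd_p by (simp add: sum.distrib sum.delta)
  finally show ?thesis .
qed

lemma frobenius_const: "[:a:] ^ p \<simeq> [:a:]"
proof -
  have nat: "[:int n:] ^ p \<simeq> [:int n:]" for n
  proof (induction n)
    case (Suc n)
    have "[:int (Suc n):] = [:int n:] + 1" by (simp add: one_pCons)
    then have "[:int (Suc n):] ^ p \<simeq> [:int n:] ^ p + 1 ^ p" using frobenius_add[of "[:int n:]" 1] by simp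
    also have "\<dots> \<simeq> [:int n:] + 1" using Suc by (simp add: eqv_add)
    finally show ?case by (simp add: one_pCons add.commute)
  qed (use odd_p in \<open>simp add: zero_power\<close>)
  have "[:a:] \<simeq> [:int (nat (a mod int p)):]"
    using odd_p by (simp add: eqv_quad minus_mod_eq_mult_div)
  from eqv_power[OF this] eqv_sym[OF this] show ?thesis using nat eqv_trans by blast
qed

text \<open>By Euler's criterion \<open>d ^ ((p - 1) / 2)\<close> is -1 modulo \<open>p\<close>, so
  the Frobenius map negates the root of \<open>d\<close>.\<close>

lemma frobenius_root: "[:0, 1:] ^ p \<simeq> [:0, -1:]"
proof -
  obtain k where k: "p = Suc (2 * k)" using prime_p odd_p prime_odd_nat oddE by (metis Suc_eq_plus1)
  have "[:0, 1:] ^ 2 \<simeq> [:d:]" by (simp add: eqv_quad power2_eq_square quad_mult)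
  from eqv_power[OF this, of k] have *: "[:0, 1:] ^ (2 * k) \<simeq> [:d ^ k:]"
    by (simp only: power_mult poly_const_pow)
  have "\<not> [d = 0] (mod int p)" using nonresidue[of 0] by (auto simp: cong_sym)
  then have "Legendre d (int p) = -1" using nonresidue by (simp add: Legendre_def QuadRes_def)
  then have "[-1 = d ^ k] (mod int p)"
    using euler_criterion[OF prime_p odd_p, of d] by (simp add: k)
  then have "[d ^ k = -1] (mod int p)" by (rule cong_sym)
  then have "[:d ^ k:] \<simeq> [:-1:]" by (simp add: eqv_quad cong_iff_dvd_diff)
  from eqv_mult[OF eqv_refl[of "[:0, 1:]"] eqv_trans[OF * this]]
  show ?thesis by (simp add: k)
qed

lemma frobenius: "f ^ p \<simeq> [:U f, - V f:]"
proof -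
  have "f \<simeq> [:U f:] + [:0, 1:] * [:V f:]" by (simp add: eqv_quad)
  from eqv_power[OF this] have "f ^ p \<simeq> ([:U f:] + [:0, 1:] * [:V f:]) ^ p" .
  also have "\<dots> \<simeq> [:U f:] ^ p + ([:0, 1:] * [:V f:]) ^ p" by (rule frobenius_add)
  also have "\<dots> \<simeq> [:U f:] + [:0, -1:] * [:V f:]"
    unfolding power_mult_distrib by (intro eqv_add eqv_mult frobenius_const frobenius_root)
  finally show ?thesis by simp
qed

lemma inverse_mod_p: "\<not> int p dvd a \<Longrightarrow> \<exists>b. [a * b = 1] (mod int p)"
  using prime_int_p by (meson cong_solve_coprime_int coprime_commute prime_imp_coprime)

text \<open>If the norm vanished modulo \<open>p\<close> with \<open>V f\<close> invertible,
  \<open>d\<close> would be the square of \<open>U f / V f\<close>.\<close>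

lemma norm_not_dvd:
  assumes "f \<notin> quad_ideal p d"
  shows "\<not> int p dvd U f * U f - d * (V f * V f)"
proof
  assume dvd: "int p dvd U f * U f - d * (V f * V f)"
  show False
  proof (cases "int p dvd V f")
    case True
    then have "int p dvd (U f * U f - d * (V f * V f)) + d * (V f * V f)"
      by (intro dvd_add dvd dvd_mult)
    then have "int p dvd U f * U f" by simp
    then have "int p dvd U f" using prime_int_p by (simp add: prime_dvd_mult_iff)
    with True assms show False by (simp add: quad_ideal_def)
  next
    case False
    then obtain b where b: "[V f * b = 1] (mod int p)" using inverse_mod_p by blast
    have "[U f * U f = d * (V f * V f)] (mod int p)" using dvd by (simp add: cong_iff_dvd_diff)
    then have "[U f * U f * (b * b) = d * (V f * V f) * (b * b)] (mod int p)" by (rule cong_scalar_right)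
    also have "d * (V f * V f) * (b * b) = d * ((V f * b) * (V f * b))" by simp
    also have "[d * ((V f * b) * (V f * b)) = d * (1 * 1)] (mod int p)" by (intro cong_mult b cong_refl)
    finally have "[(U f * b)\<^sup>2 = d] (mod int p)" by (simp add: power2_eq_square ac_simps)
    with nonresidue show False by blast
  qed
qed

text \<open>Frobenius is conjugation, so \<open>y ^ p + y\<close> is the trace
  \<open>2 * U y\<close> and \<open>x ^ Suc p\<close> the norm of \<open>x\<close>. The fibre
  equation fixes the first coordinate of \<open>y\<close> and leaves the second free, which gives
  \<open>p\<close> solutions.\<close>

lemma residue_field_sq: "residue_field_sq (quad_ideal p d) (quad_reps p) p"
proof unfold_locales
  fix x :: "int poly" and k :: nat
  show "x \<notin> quad_ideal p d \<Longrightarrow> \<exists>y. x * y - 1 \<in> quad_ideal p d"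
  proof -
    assume "x \<notin> quad_ideal p d"
    then obtain b where b: "[(U x * U x - d * (V x * V x)) * b = 1] (mod int p)"
      using norm_not_dvd inverse_mod_p by blast
    \<comment> \<open>The inverse is the conjugate divided by the norm.\<close>
    have "x * [:U x * b, - V x * b:] - 1 \<in> quad_ideal p d"
      using b unfolding quad_ideal_def mem_Collect_eq quad_diff quad_mult
      by (simp add: one_pCons cong_iff_dvd_diff algebra_simps)
    then show ?thesis by blast
  qed
  show "of_nat k \<in> quad_ideal p d \<longleftrightarrow> p dvd k"
    by (simp add: quad_ideal_def of_nat_poly)
  show "\<exists>!c. c \<in> quad_reps p \<and> x - c \<in> quad_ideal p d"
  proof
    show "[:U x mod int p, V x mod int p:] \<in> quad_reps p \<and> x - [:U x mod int p, V x mod int p:] \<in> quad_ideal p d"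
      using odd_p by (auto simp: quad_reps_def quad_ideal_def quad_diff minus_mod_eq_mult_div image_iff)
  next
    fix c assume c: "c \<in> quad_reps p \<and> x - c \<in> quad_ideal p d"
    then obtain a b where ab: "c = [:a, b:]" "0 \<le> a" "a < int p" "0 \<le> b" "b < int p"
      by (auto simp: quad_reps_def)
    then have "[U x = a] (mod int p)" "[V x = b] (mod int p)"
      using c by (auto simp: quad_ideal_def quad_diff cong_iff_dvd_diff)
    with ab show "c = [:U x mod int p, V x mod int p:]" by (simp add: cong_def)
  qed
  have inj: "inj_on (\<lambda>(a, b). [:a, b::int:]) S" for S by (auto simp: inj_on_def)
  show "card (quad_reps p) = p * p"
    unfolding quad_reps_def by (simp add: card_image inj card_cartesian_product)
  show "2 \<le> p" using odd_p by simp
  have "x ^ (p * p) \<simeq> [:U (x ^ p), - V (x ^ p):]" using frobenius[of "x ^ p"] by (simp add: power_mult)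
  also have "\<dots> \<simeq> x"
  proof -
    have "int p dvd U (x ^ p) - U x" "int p dvd V (x ^ p) + V x"
      using frobenius[of x] unfolding eqv_quad by simp_all
    then have "int p dvd - (V (x ^ p) + V x)" by (simp only: dvd_minus_iff)
    with \<open>int p dvd U (x ^ p) - U x\<close> show ?thesis unfolding eqv_quad by simp
  qed
  finally show "x ^ (p * p) - x \<in> quad_ideal p d" by (simp add: eqv_def)
  define n where "n = U x * U x - d * (V x * V x)"
  have x: "x ^ Suc p \<simeq> [:n:]"
  proof -
    have "x ^ Suc p \<simeq> x * [:U x, - V x:]"
      using eqv_mult[OF eqv_refl[of x] frobenius[of x]] by (simp only: power_Suc)
    also have "\<dots> \<simeq> [:n:]" unfolding eqv_quad quad_mult n_def by (simp add: algebra_simps)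
    finally show ?thesis .
  qed
  have y: "y ^ p + y \<simeq> [:2 * U y:]" for y
  proof -
    have "y ^ p + y \<simeq> [:U y, - V y:] + y" by (intro eqv_add frobenius eqv_refl)
    also have "\<dots> \<simeq> [:2 * U y:]" unfolding eqv_quad quad_add by simp
    finally show ?thesis .
  qed
  \<comment> \<open>\<open>h = (p + 1) / 2\<close> is the inverse of 2 modulo
    \<open>p\<close>.\<close>
  obtain h where h: "int p = 2 * h - 1" using prime_p odd_p prime_odd_nat
    by (metis add_diff_cancel_right' evenE even_of_nat even_plus_one_iff of_nat_1 of_nat_add)
  have half: "int p dvd 2 * a - n \<longleftrightarrow> a = (h * n) mod int p" if "0 \<le> a" "a < int p" for a
  proof -
    have "[2 * h = 1] (mod int p)" by (simp add: cong_iff_dvd_diff h)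
    have "[2 * a = n] (mod int p) \<longleftrightarrow> [a = h * n] (mod int p)"
    proof
      assume "[2 * a = n] (mod int p)"
      then have "[h * (2 * a) = h * n] (mod int p)" by (rule cong_scalar_left)
      moreover have "[2 * h * a = 1 * a] (mod int p)" by (rule cong_scalar_right) fact
      ultimately show "[a = h * n] (mod int p)" by (metis cong_sym cong_trans mult.assoc mult.commute mult_1)
    next
      assume "[a = h * n] (mod int p)"
      then have "[2 * a = 2 * (h * n)] (mod int p)" by (rule cong_scalar_left)
      moreover have "[2 * h * n = 1 * n] (mod int p)" by (rule cong_scalar_right) fact
      ultimately show "[2 * a = n] (mod int p)" by (metis cong_trans mult.assoc mult_1)
    qed
    then show ?thesis using that by (simp add: cong_iff_dvd_diff[symmetric] cong_def)
  qed
  have "{y \<in> quad_reps p. y ^ p + y - x ^ Suc p \<in> quad_ideal p d}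
      = (\<lambda>(a, b). [:a, b:]) ` ({(h * n) mod int p} \<times> {0..<int p})"
  proof -
    have "y ^ p + y - x ^ Suc p \<in> quad_ideal p d \<longleftrightarrow> int p dvd 2 * U y - n" for y
    proof -
      have "y ^ p + y \<simeq> x ^ Suc p \<longleftrightarrow> [:2 * U y:] \<simeq> [:n:]"
        using x y by (meson eqv_sym eqv_trans)
      then show ?thesis by (simp add: eqv_def[symmetric]) (simp add: eqv_quad)
    qed
    then show ?thesis using half odd_p by (auto simp: quad_reps_def)
  qed
  then show "card {y \<in> quad_reps p. y ^ p + y - x ^ Suc p \<in> quad_ideal p d} = p"
    by (simp add: card_image inj card_cartesian_product)
qed

end

section \<open>Chebyshev's lower bound on the number of primes\<close>

text \<open>Legendre's formula, truncated at \<open>m\<close> because higher powers of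
  \<open>p\<close> exceed \<open>n\<close>.\<close>

lemma multiplicity_fact_prime:
  fixes p n m :: nat
  assumes "prime p" "n < p ^ Suc m"
  shows "multiplicity p (fact n) = (\<Sum>i=1..m. n div p ^ i)"
  using assms(2)
proof (induction n)
  case (Suc n)
  have p: "1 < p" using assms(1) prime_gt_1_nat by blast
  have "p ^ multiplicity p (Suc n) \<le> Suc n" by (intro dvd_imp_le multiplicity_dvd) simp
  also have "\<dots> < p ^ Suc m" by (rule Suc.prems)
  finally have "multiplicity p (Suc n) \<le> m" using p by (simp only: power_strict_increasing_iff less_Suc_eq_le)
  then have "{i \<in> {1..m}. p ^ i dvd Suc n} = {1..multiplicity p (Suc n)}"
    using p by (auto simp: power_dvd_iff_le_multiplicity)
  then have "(\<Sum>i=1..m. if p ^ i dvd Suc n then 1 else 0) = multiplicity p (Suc n)"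
    by (simp add: sum.inter_filter[symmetric])
  moreover have "(\<Sum>i=1..m. Suc n div p ^ i) = (\<Sum>i=1..m. n div p ^ i + (if p ^ i dvd Suc n then 1 else 0))"
    by (intro sum.cong) (auto simp: div_Suc dvd_eq_mod_eq_0)
  moreover have "multiplicity p (fact (Suc n)) = multiplicity p (Suc n) + multiplicity p (fact n :: nat)"
    using assms(1) unfolding fact_Suc of_nat_id by (intro prime_elem_multiplicity_mult_distrib) auto
  ultimately show ?case using Suc by (simp add: sum.distrib)
qed simp

text \<open>In Legendre's formula every power up to \<open>2 * n\<close> contributes at most 1,
  since \<open>(2 * n) div k\<close> exceeds \<open>2 * (n div k)\<close> by at most 1.\<close>

lemma prime_power_central_binomial_le:
  fixes p n :: nat
  assumes "prime p" "0 < n"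
  shows "p ^ multiplicity p (2 * n choose n) \<le> 2 * n"
proof -
  have p: "1 < p" using assms(1) prime_gt_1_nat by blast
  obtain m where m: "p ^ m \<le> 2 * n" "2 * n < p ^ Suc m"
    using ex_power_ivl1[of p "2 * n"] p assms(2) by auto
  have "(fact (2 * n) :: nat) = fact n * fact n * (2 * n choose n)"
    using binomial_fact_lemma[of n "2 * n"] by (simp add: mult_2)
  then have "multiplicity p (fact (2 * n) :: nat)
      = multiplicity p (fact n :: nat) + multiplicity p (fact n :: nat) + multiplicity p (2 * n choose n)"
    using assms(1) by (simp add: prime_elem_multiplicity_mult_distrib)
  then have "(\<Sum>i=1..m. (2 * n) div p ^ i) = 2 * (\<Sum>i=1..m. n div p ^ i) + multiplicity p (2 * n choose n)"
    using multiplicity_fact_prime[OF assms(1), of "2 * n" m] multiplicity_fact_prime[OF assms(1), of n m] m by simp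
  moreover have "(\<Sum>i=1..m. (2 * n) div p ^ i) \<le> (\<Sum>i=1..m. 2 * (n div p ^ i) + 1)"
  proof (rule sum_mono)
    fix i
    have "0 < p ^ i" using p by simp
    then have "2 * n < (2 * (n div p ^ i) + 2) * p ^ i"
      using dividend_less_div_times[of "p ^ i" n] by (simp add: algebra_simps)
    then show "(2 * n) div p ^ i \<le> 2 * (n div p ^ i) + 1"
      using less_mult_imp_div_less[of "2 * n" "2 * (n div p ^ i) + 2" "p ^ i"] by simp
  qed
  moreover have "(\<Sum>i=1..m. 2 * (n div p ^ i) + 1) = 2 * (\<Sum>i=1..m. n div p ^ i) + m"
    by (simp only: sum.distrib sum_distrib_left) simp
  ultimately have "multiplicity p (2 * n choose n) \<le> m" by linarith
  then have "p ^ multiplicity p (2 * n choose n) \<le> p ^ m" using p by (intro power_increasing) auto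
  with m(1) show ?thesis by simp
qed

text \<open>The central binomial coefficient is at least \<open>2 ^ n\<close>, and each of its prime
  power factors is at most \<open>2 * n\<close>.\<close>

lemma chebyshev_lower:
  fixes n :: nat
  assumes "0 < n"
  shows "2 ^ n \<le> (2 * n) ^ card {p. prime p \<and> p \<le> 2 * n}"
proof -
  let ?B = "2 * n choose n"
  have B0: "?B \<noteq> 0" by simp
  have fin: "finite {p. prime p \<and> p \<le> 2 * n}" by (rule finite_subset[of _ "{..2 * n}"]) auto
  have "real (2 ^ n) \<le> real ?B"
    using binomial_ge_n_over_k_pow_k[of n "2 * n", where ?'a = real] assms by simp
  then have "2 ^ n \<le> ?B" by (simp only: of_nat_le_iff)
  also have "?B = (\<Prod>p\<in>prime_factors ?B. p ^ multiplicity p ?B)"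
    using prod_prime_factors[OF B0] by simp
  also have "\<dots> \<le> (\<Prod>p\<in>prime_factors ?B. 2 * n)"
    by (intro prod_mono) (use assms in \<open>auto intro: prime_power_central_binomial_le\<close>)
  also have "\<dots> = (2 * n) ^ card (prime_factors ?B)" by simp
  also have "\<dots> \<le> (2 * n) ^ card {p. prime p \<and> p \<le> 2 * n}"
  proof (intro power_increasing card_mono fin subsetI)
    fix p assume p: "p \<in> prime_factors ?B"
    then have "prime p" "p dvd ?B" by auto
    then have "1 \<le> multiplicity p ?B" using B0 by (simp add: Suc_leI prime_multiplicity_gt_zero_iff)
    then have "p ^ 1 \<le> p ^ multiplicity p ?B" using \<open>prime p\<close> prime_gt_0_nat by (intro power_increasing) (auto simp: Suc_leI)
    also have "\<dots> \<le> 2 * n" by (rule prime_power_central_binomial_le) fact+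
    finally show "p \<in> {p. prime p \<and> p \<le> 2 * n}" using \<open>prime p\<close> by simp
  qed (use assms in simp)
  finally show ?thesis .
qed

section \<open>Protocols on bit strings\<close>

abbreviation bits_val :: "bool list \<Rightarrow> nat" where "bits_val w \<equiv> horner_sum of_bool 2 w"

definition bits :: "nat \<Rightarrow> nat \<Rightarrow> bool list" where "bits k x = map (bit x) [0..<k]"

lemma length_bits [simp]: "length (bits k x) = k"
  by (simp add: bits_def)

lemma bits_val_bits: "x < 2 ^ k \<Longrightarrow> bits_val (bits k x) = x"
  by (simp add: bits_def horner_sum_bit_eq_take_bit take_bit_nat_eq_self)

lemma bits_bits_val: "length w = k \<Longrightarrow> bits k (bits_val w) = w"
  by (intro nth_equalityI) (auto simp: bits_def bit_horner_sum_bit_iff)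

lemma bits_val_less: "bits_val w < 2 ^ length w"
  by (rule horner_sum_of_bool_2_less)

definition chunk :: "nat \<Rightarrow> nat \<Rightarrow> 'a list \<Rightarrow> 'a list" where
  "chunk k i w = take k (drop (i * k) w)"

definition pack :: "nat \<Rightarrow> nat list \<Rightarrow> bool list" where
  "pack k xs = concat (map (bits k) xs)"

lemma length_pack: "length (pack k xs) = length xs * k"
  by (induction xs) (auto simp: pack_def)

lemma chunk_pack: "i < length xs \<Longrightarrow> chunk k i (pack k xs) = bits k (xs ! i)"
proof (induction xs arbitrary: i)
  case (Cons x xs)
  then show ?case
    by (cases i) (auto simp: chunk_def pack_def)
qed simp

lemma bits_val_chunk_pack:
  assumes "i < length xs" "xs ! i < 2 ^ k"
  shows "bits_val (chunk k i (pack k xs)) = xs ! i"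
  using assms by (simp add: chunk_pack bits_val_bits)

lemma bits_val_chunk_less: "bits_val (chunk k i w) < 2 ^ k"
proof -
  have "bits_val (chunk k i w) < 2 ^ length (chunk k i w)" by (rule bits_val_less)
  also have "\<dots> \<le> 2 ^ k" by (intro power_increasing) (auto simp: chunk_def)
  finally show ?thesis .
qed

section \<open>Counting public coins by residues\<close>

lemma finite_bitstrings: "finite (bitstrings k)"
  and card_bitstrings: "card (bitstrings k) = 2 ^ k"
  using finite_lists_length_eq[of "UNIV :: bool set" k] card_lists_length_eq[of "UNIV :: bool set" k]
  by (simp_all add: bitstrings_def)

lemma bitstrings_nonempty: "bitstrings k \<noteq> {}"
  using card_bitstrings[of k] by (metis card.empty power_not_zero zero_neq_numeral)

lemma inj_on_bits_val: "inj_on bits_val (bitstrings k)"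
  by (rule inj_on_inverseI[of _ "bits k"]) (simp add: bitstrings_def bits_bits_val)

lemma prob_bitstrings:
  "measure_pmf.prob (pmf_of_set (bitstrings k)) A = card (bitstrings k \<inter> A) / 2 ^ k"
  using measure_pmf_of_set[OF bitstrings_nonempty finite_bitstrings, of k A] by (simp add: card_bitstrings)

lemma card_mod_le:
  fixes M T :: nat
  assumes "0 < M"
  shows "card {x \<in> {..<T}. Q (x mod M)} \<le> card {y \<in> {..<M}. Q y} * (T div M + 1)"
proof -
  have "inj_on (\<lambda>x. (x mod M, x div M)) {x \<in> {..<T}. Q (x mod M)}"
    by (rule inj_onI) (metis Pair_inject div_mult_mod_eq)
  moreover have "(\<lambda>x. (x mod M, x div M)) ` {x \<in> {..<T}. Q (x mod M)} \<subseteq> {y \<in> {..<M}. Q y} \<times> {..T div M}"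
    using assms by (auto intro: div_le_mono)
  ultimately have "card {x \<in> {..<T}. Q (x mod M)} \<le> card ({y \<in> {..<M}. Q y} \<times> {..T div M})"
    by (intro card_inj_on_le) auto
  then show ?thesis by (simp add: card_cartesian_product)
qed

lemma card_mod_le_dvd:
  fixes M N :: nat
  assumes "0 < N"
  shows "card {x \<in> {..<N * M}. Q (x mod N)} \<le> card {y \<in> {..<N}. Q y} * M"
proof -
  have "inj_on (\<lambda>x. (x mod N, x div N)) {x \<in> {..<N * M}. Q (x mod N)}"
    by (rule inj_onI) (metis Pair_inject div_mult_mod_eq)
  moreover have "(\<lambda>x. (x mod N, x div N)) ` {x \<in> {..<N * M}. Q (x mod N)} \<subseteq> {y \<in> {..<N}. Q y} \<times> {..<M}"
    using assms by (auto simp: less_mult_imp_div_less mult.commute)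
  ultimately have "card {x \<in> {..<N * M}. Q (x mod N)} \<le> card ({y \<in> {..<N}. Q y} \<times> {..<M})"
    by (intro card_inj_on_le) auto
  then show ?thesis by (simp add: card_cartesian_product)
qed

text \<open>For splitting one random number into the index of a check and the randomness used inside
  it.\<close>

lemma card_divmod_le:
  fixes K M :: nat
  assumes "0 < K"
  shows "card {x \<in> {..<K * M}. Q (x mod K) (x div K)} \<le> (\<Sum>i<K. card {z \<in> {..<M}. Q i z})"
proof -
  have "inj_on (\<lambda>x. (x mod K, x div K)) {x \<in> {..<K * M}. Q (x mod K) (x div K)}"
    by (rule inj_onI) (metis Pair_inject div_mult_mod_eq)
  moreover have "(\<lambda>x. (x mod K, x div K)) ` {x \<in> {..<K * M}. Q (x mod K) (x div K)}
      \<subseteq> (SIGMA i:{..<K}. {z \<in> {..<M}. Q i z})"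
    using assms by (auto simp: less_mult_imp_div_less mult.commute)
  ultimately have "card {x \<in> {..<K * M}. Q (x mod K) (x div K)} \<le> card (SIGMA i:{..<K}. {z \<in> {..<M}. Q i z})"
    by (intro card_inj_on_le) auto
  then show ?thesis by simp
qed

text \<open>Residues of \<open>2 ^ c\<close> equally likely numbers modulo \<open>M\<close> are not
  uniform, but for \<open>M \<le> 2 ^ c\<close> no residue is more than twice as likely as under the
  uniform distribution. So 1/6 becomes 1/3.\<close>

lemma prob_mod_le:
  assumes "0 < M" "M \<le> 2 ^ c" "6 * card {y \<in> {..<M}. Q y} \<le> M"
  shows "measure_pmf.prob (pmf_of_set (bitstrings c)) {r. Q (bits_val r mod M)} \<le> 1 / 3"
proof -
  define T :: nat where "T = 2 ^ c"
  have "bits_val ` (bitstrings c \<inter> {r. Q (bits_val r mod M)}) \<subseteq> {x \<in> {..<T}. Q (x mod M)}"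
    using bits_val_less by (auto simp: bitstrings_def T_def)
  then have "card (bitstrings c \<inter> {r. Q (bits_val r mod M)}) \<le> card {x \<in> {..<T}. Q (x mod M)}"
    by (intro card_inj_on_le[of bits_val] inj_on_subset[OF inj_on_bits_val]) auto
  also have "\<dots> \<le> card {y \<in> {..<M}. Q y} * (T div M + 1)" by (rule card_mod_le[OF assms(1)])
  finally have "6 * card (bitstrings c \<inter> {r. Q (bits_val r mod M)}) \<le> (6 * card {y \<in> {..<M}. Q y}) * (T div M + 1)"
    by simp
  also have "\<dots> \<le> M * (T div M + 1)" by (intro mult_right_mono assms) simp
  also have "\<dots> \<le> 2 * T"
  proof -
    have "M * (T div M) \<le> T" by (rule times_div_less_eq_dividend)
    moreover have "M \<le> T" using assms(2) by (simp add: T_def)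
    ultimately show ?thesis unfolding distrib_left mult_1_right by linarith
  qed
  finally have "3 * card (bitstrings c \<inter> {r. Q (bits_val r mod M)}) \<le> T" by simp
  then have "3 * real (card (bitstrings c \<inter> {r. Q (bits_val r mod M)})) \<le> 2 ^ c"
    by (simp only: T_def flip: of_nat_le_iff[where ?'a = real]) simp
  then show ?thesis unfolding prob_bitstrings by (simp add: field_simps)
qed

section \<open>Combining the checks into a protocol\<close>

text \<open>Positions past \<open>n\<close> are padded with \<open>False\<close>, which adds nothing
  to the inner product.\<close>

definition row :: "nat \<Rightarrow> nat \<Rightarrow> bool list \<Rightarrow> nat \<Rightarrow> nat \<Rightarrow> bool" where
  "row n t X j i \<longleftrightarrow> j * t + i < n \<and> X ! (j * t + i)"

lemma bool_inner_row:
  assumes "n \<le> J * t"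
  shows "bool_inner J t (row n t X) (row n t Y) = IP n X Y"
proof -
  define g :: "nat \<Rightarrow> nat" where "g k = (if k < n then of_bool (X ! k) * of_bool (Y ! k) else 0)" for k
  have "bool_inner J t (row n t X) (row n t Y) = (\<Sum>j<J. \<Sum>i<t. g (j * t + i))"
    unfolding bool_inner_def by (intro sum.cong) (auto simp: row_def g_def)
  also have "\<dots> = (\<Sum>j<J. sum g {j * t..<j * t + t})"
  proof (rule sum.cong[OF refl])
    fix j
    show "(\<Sum>i<t. g (j * t + i)) = sum g {j * t..<j * t + t}"
      using sum.shift_bounds_nat_ivl[of g 0 "j * t" t] by (simp add: lessThan_atLeast0 add.commute)
  qed
  also have "\<dots> = sum g {..<J * t}" by (rule sum.nat_group)
  also have "\<dots> = sum g {..<n}"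
    by (rule sum.mono_neutral_right) (use assms in \<open>auto simp: g_def\<close>)
  also have "\<dots> = IP n X Y" unfolding IP_def by (intro sum.cong) (auto simp: g_def)
  finally show ?thesis .
qed

lemma IP_le: "IP n X Y \<le> n"
proof -
  have "IP n X Y \<le> (\<Sum>i<n. 1)" unfolding IP_def by (rule sum_mono) simp
  then show ?thesis by simp
qed

text \<open>The error is at most 1/12 for picking a check whose modulus misses the wrong value, plus
  1/12 for a failing check, and the sum 1/6 is doubled by \<open>prob_mod_le\<close>.\<close>

lemma protocol_from_gadgets:
  fixes p N :: "nat \<Rightarrow> nat"
  assumes K: "0 < K" and n: "n \<le> J * t" "n < 2 ^ l"
    and g: "\<And>i. i < K \<Longrightarrow> gadget (p i) J t (2 ^ u) (2 ^ s) (N i) (enc i) (acc i)"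
    and p: "\<And>v v'. v < 2 ^ l \<Longrightarrow> v' < 2 ^ l \<Longrightarrow> v \<noteq> v' \<Longrightarrow> 12 * card {i \<in> {..<K}. [v = v'] (mod p i)} \<le> K"
  shows "\<exists>P. ma_computes n P (IP n) \<and> ma_cost P = l + K * u + J * s"
proof -
  \<comment> \<open>A common multiple of all \<open>N i\<close>, so that reduction modulo any
    \<open>N i\<close> stays uniform.\<close>
  define NN where "NN = (\<Prod>i<K. N i)"
  define M where "M = K * NN"
  have N0: "0 < N i" if "i < K" for i using g[OF that] by (simp add: gadget_def)
  then have "0 < NN" by (auto simp: NN_def intro: prod_pos)
  then have M0: "0 < M" using K by (simp add: M_def)
  define idx where "idx x = x mod K" for x
  define pt where "pt x = (x div K) mod N (idx x)" for x
  \<comment> \<open>The advice is the claim followed by one proof of \<open>u\<close> bits per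
    check. Coins are free, so \<open>M\<close> of them are taken, which suffices since
    \<open>M < 2 ^ M\<close>.\<close>
  define P where "P = \<lparr>advice_len = l + K * u, coin_len = M, message_len = J * s,
    bob = (\<lambda>Y r. let x = bits_val r mod M in pack s (map (\<lambda>j. enc (idx x) (row n t Y j) (pt x)) [0..<J])),
    alice = (\<lambda>X w r m. let x = bits_val r mod M in
       acc (idx x) (row n t X) (bits_val (take l w)) (bits_val (chunk u (idx x) (drop l w))) (pt x)
         (map (\<lambda>j. bits_val (chunk s j m)) [0..<J]))\<rparr>"
  have idx: "idx x < K" for x using K by (simp add: idx_def)
  have pt: "pt x < N (idx x)" for x using N0[OF idx] by (simp add: pt_def)
  have accept: "alice P X w r (bob P Y r) \<longleftrightarrow> (let x = bits_val r mod M in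
      acc (idx x) (row n t X) (bits_val (take l w)) (bits_val (chunk u (idx x) (drop l w))) (pt x)
        (map (\<lambda>j. enc (idx x) (row n t Y j) (pt x)) [0..<J]))" for X Y w r
  proof -
    define x where "x = bits_val r mod M"
    have "bits_val (chunk s j (bob P Y r)) = enc (idx x) (row n t Y j) (pt x)" if "j < J" for j
      using g[OF idx[of x]] that bits_val_chunk_pack[of j "map (\<lambda>j. enc (idx x) (row n t Y j) (pt x)) [0..<J]" s]
      by (simp add: P_def x_def[symmetric] Let_def gadget_def)
    then have "map (\<lambda>j. bits_val (chunk s j (bob P Y r))) [0..<J] = map (\<lambda>j. enc (idx x) (row n t Y j) (pt x)) [0..<J]"
      by (intro map_cong) auto
    moreover have "alice P X w r m \<longleftrightarrow> acc (idx x) (row n t X) (bits_val (take l w)) (bits_val (chunk u (idx x) (drop l w))) (pt x)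
         (map (\<lambda>j. bits_val (chunk s j m)) [0..<J])" for m by (simp add: P_def x_def Let_def)
    ultimately show ?thesis by (simp only: x_def[symmetric] Let_def)
  qed
  have complete: "\<exists>w\<in>bitstrings (l + K * u). bits_val (take l w) = IP n X Y \<and> accept_prob P X Y w \<ge> 2/3" for X Y
  proof -
    have "\<exists>w<2 ^ u. \<forall>r<N i. acc i (row n t X) (IP n X Y) w r (map (\<lambda>j. enc i (row n t Y j) r) [0..<J])"
      if "i < K" for i
      using g[OF that] cong_refl unfolding gadget_def bool_inner_row[OF n(1), symmetric] by blast
    then obtain W where W: "\<And>i. i < K \<Longrightarrow> W i < 2 ^ u" "\<And>i r. i < K \<Longrightarrow> r < N i \<Longrightarrow>
        acc i (row n t X) (IP n X Y) (W i) r (map (\<lambda>j. enc i (row n t Y j) r) [0..<J])"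
      by metis
    define w where "w = bits l (IP n X Y) @ pack u (map W [0..<K])"
    have "IP n X Y < 2 ^ l" using IP_le n(2) by (rule le_less_trans)
    then have v: "bits_val (take l w) = IP n X Y" by (simp add: w_def bits_val_bits)
    have ch: "bits_val (chunk u i (drop l w)) = W i" if "i < K" for i
      using bits_val_chunk_pack[of i "map W [0..<K]" u] W(1)[OF that] that by (simp add: w_def)
    have "alice P X w r (bob P Y r)" for r
      unfolding accept Let_def v ch[OF idx] by (rule W(2)[OF idx pt])
    then have "accept_prob P X Y w = 1"
      by (simp add: accept_prob_def prob_bitstrings card_bitstrings)
    moreover have "w \<in> bitstrings (l + K * u)" by (simp add: bitstrings_def w_def length_pack)
    ultimately show ?thesis using v by (intro bexI[of _ w]) auto
  qed
  have sound: "accept_prob P X Y w \<le> 1/3"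
    if w: "w \<in> bitstrings (l + K * u)" "bits_val (take l w) \<noteq> IP n X Y" for X Y w
  proof -
    define v where "v = bits_val (take l w)"
    have v: "v < 2 ^ l" using bits_val_less[of "take l w"] w(1) by (simp add: v_def bitstrings_def)
    have IP: "IP n X Y < 2 ^ l" using IP_le n(2) by (rule le_less_trans)
    define Q where "Q i r = acc i (row n t X) v (bits_val (chunk u i (drop l w))) r (map (\<lambda>j. enc i (row n t Y j) r) [0..<J])" for i r
    define bad where "bad = {i \<in> {..<K}. [v = IP n X Y] (mod p i)}"
    have "12 * card bad \<le> K" unfolding bad_def by (rule p[OF v IP]) (use w(2) in \<open>simp add: v_def\<close>)
    have one: "12 * card {z \<in> {..<NN}. Q i (z mod N i)} \<le> NN + 12 * (if i \<in> bad then NN else 0)" if i: "i < K" for i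
    proof (cases "i \<in> bad")
      case True
      have "card {z \<in> {..<NN}. Q i (z mod N i)} \<le> card {..<NN}" by (intro card_mono) auto
      with True show ?thesis by simp
    next
      case False
      then have "\<not> [v = IP n X Y] (mod p i)" using i by (simp add: bad_def)
      then have *: "12 * card {r \<in> {..<N i}. Q i r} \<le> N i"
        using g[OF i] bits_val_chunk_less[of u i "drop l w"] unfolding gadget_def Q_def bool_inner_row[OF n(1), symmetric] by blast
      have "N i dvd NN" unfolding NN_def by (rule dvd_prodI) (use i in auto)
      then obtain m where m: "NN = N i * m" by auto
      have "12 * card {z \<in> {..<NN}. Q i (z mod N i)} \<le> 12 * (card {r \<in> {..<N i}. Q i r} * m)"
        unfolding m by (intro mult_left_mono card_mod_le_dvd N0 i) simp
      also have "\<dots> \<le> N i * m" using mult_right_mono[OF *, of m] by simp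
      finally show ?thesis using m by simp
    qed
    have "12 * card {x \<in> {..<M}. Q (idx x) (pt x)} \<le> 12 * (\<Sum>i<K. card {z \<in> {..<NN}. Q i (z mod N i)})"
      unfolding M_def idx_def pt_def by (intro mult_left_mono card_divmod_le[OF K, where Q = "\<lambda>i z. Q i (z mod N i)"]) simp
    also have "\<dots> \<le> (\<Sum>i<K. NN + 12 * (if i \<in> bad then NN else 0))"
      unfolding sum_distrib_left by (intro sum_mono one) simp
    also have "\<dots> = K * NN + 12 * card bad * NN"
    proof -
      have "{i. i < K} \<inter> bad = bad" "{..<K} \<inter> bad = bad" by (auto simp: bad_def)
      then have "(\<Sum>i<K. if i \<in> bad then NN else 0) = card bad * NN" by (simp add: sum.If_cases)
      then show ?thesis by (simp add: sum.distrib sum_distrib_left[symmetric])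
    qed
    also have "\<dots> \<le> K * NN + K * NN" by (intro add_left_mono mult_right_mono) (fact, simp)
    finally have "6 * card {x \<in> {..<M}. Q (idx x) (pt x)} \<le> M" by (simp add: M_def)
    from prob_mod_le[OF M0 _ this, of M] show ?thesis
      unfolding accept_prob_def accept Let_def Q_def v_def by (simp add: P_def less_imp_le)
  qed
  have "ma_wf n P"
    by (simp add: ma_wf_def P_def bitstrings_def Let_def length_pack)
  moreover have "advice_len P = l + K * u" by (simp add: P_def)
  ultimately have "ma_computes n P (IP n)"
    unfolding ma_computes_def claimed_value_def using complete sound
    by (intro conjI exI[of _ l]) auto
  moreover have "ma_cost P = l + K * u + J * s" by (simp add: ma_cost_def P_def)
  ultimately show ?thesis by blast
qed

text \<open>A nonzero claim is refused outright, and a claim of 0 is a wrong value exactly when the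
  answer is no.\<close>

lemma decides_from_computes:
  assumes "ma_computes n P f"
  shows "\<exists>P'. ma_decides n P' (\<lambda>X Y. f X Y = 0) \<and> ma_cost P' = ma_cost P"
proof -
  from assms obtain l where wf: "ma_wf n P" and l: "l \<le> advice_len P"
    and complete: "\<And>X Y. X \<in> bitstrings n \<Longrightarrow> Y \<in> bitstrings n \<Longrightarrow>
       \<exists>w\<in>bitstrings (advice_len P). claimed_value l w = f X Y \<and> accept_prob P X Y w \<ge> 2/3"
    and sound: "\<And>X Y w. X \<in> bitstrings n \<Longrightarrow> Y \<in> bitstrings n \<Longrightarrow> w \<in> bitstrings (advice_len P) \<Longrightarrow>
       claimed_value l w \<noteq> f X Y \<Longrightarrow> accept_prob P X Y w \<le> 1/3"
    unfolding ma_computes_def by blast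
  define P' where "P' = P\<lparr>alice := (\<lambda>X w r m. claimed_value l w = 0 \<and> alice P X w r m)\<rparr>"
  have acc: "accept_prob P' X Y w = (if claimed_value l w = 0 then accept_prob P X Y w else 0)" for X Y w
    by (simp add: accept_prob_def P'_def)
  have adv: "advice_len P' = advice_len P" by (simp add: P'_def)
  have "ma_decides n P' (\<lambda>X Y. f X Y = 0)"
    unfolding ma_decides_def
  proof (intro conjI ballI impI)
    show "ma_wf n P'" using wf by (simp add: ma_wf_def P'_def)
    fix X Y assume XY: "X \<in> bitstrings n" "Y \<in> bitstrings n"
    show "\<exists>w\<in>bitstrings (advice_len P'). 2 / 3 \<le> accept_prob P' X Y w" if "f X Y = 0"
      using complete[OF XY] that unfolding acc adv by force
    show "accept_prob P' X Y w \<le> 1 / 3" if "f X Y \<noteq> 0" "w \<in> bitstrings (advice_len P')" for w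
      using sound[OF XY, of w] that by (auto simp: acc adv)
  qed
  moreover have "ma_cost P' = ma_cost P" by (simp add: ma_cost_def P'_def)
  ultimately show ?thesis by blast
qed

section \<open>Choice of parameters\<close>

text \<open>Fits the tower to a given block length: \<open>X\<close> counts the points of level
  \<open>L\<close> above \<open>2 * a * q\<close> base values, and \<open>B\<close> points per fibre
  over them give between \<open>t\<close> and \<open>2 * t\<close> positions. Hence the exponent
  \<open>32 * t\<close>.\<close>

lemma prime_gadget:
  fixes a t q J :: nat
  assumes q: "prime q" "168 * a \<le> q" and t: "2 * a * q \<le> t" "t < 2 ^ Suc a" and a: "0 < a"
    and D: "q ^ (32 * t) \<le> D" and S: "q * q \<le> S"
  shows "\<exists>N enc acc. gadget q J t D S N enc acc"
proof -
  have q2: "2 < q" using q a by simp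
  define A where "A = 2 * a * q"
  have A0: "0 < A" using a q2 by (simp add: A_def)
  then have "1 \<le> t div A" using t(1) div_le_mono[of A t A] by (simp add: A_def)
  with ex_power_ivl1[of q "t div A"] q2 obtain L where L: "q ^ L \<le> t div A" "t div A < q ^ Suc L" by auto
  define X where "X = A * q ^ L"
  have X0: "0 < X" using A0 q2 by (simp add: X_def)
  have "X \<le> A * (t div A)" unfolding X_def using L(1) by (rule mult_left_mono) simp
  also have "\<dots> \<le> t" by (rule times_div_less_eq_dividend)
  finally have Xt: "X \<le> t" .
  have tX: "t < X * q"
    using L(2) A0 unfolding X_def by (simp add: div_less_iff_less_mult mult.commute mult.left_commute)
  \<comment> \<open>From \<open>2 ^ Suc L \<le> X \<le> t < 2 ^ Suc a\<close>.\<close>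
  have "L < a"
  proof -
    have "(2::nat) ^ L \<le> q ^ L" using q2 by (intro power_mono) auto
    moreover have "2 * q ^ L \<le> X" unfolding X_def A_def by (intro mult_right_mono) (use a q2 in auto)
    ultimately have "(2::nat) ^ Suc L < 2 ^ Suc a" using Xt t(2) unfolding power_Suc by linarith
    then show ?thesis using power_less_imp_less_exp[of "2::nat" "Suc L" "Suc a"] by simp
  qed
  \<comment> \<open>The quotient \<open>t / X\<close> rounded up.\<close>
  define B where "B = (t - 1) div X + 1"
  have "0 < t" using Xt X0 by linarith
  have "t \<le> X * B"
    using X0 \<open>0 < t\<close> dividend_less_times_div[of X "t - 1"] unfolding B_def by (simp add: algebra_simps)
  have "X * B \<le> 2 * t"
  proof -
    have "X * ((t - 1) div X) \<le> t - 1" by (rule times_div_less_eq_dividend)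
    with Xt show ?thesis unfolding B_def distrib_left mult_1_right by linarith
  qed
  have "B \<le> q"
  proof -
    have "t - 1 < q * X" using tX by (simp add: mult.commute)
    then have "(t - 1) div X < q" by (rule less_mult_imp_div_less)
    then show ?thesis by (simp add: B_def)
  qed
  obtain d where d: "\<And>y::int. \<not> [y\<^sup>2 = d] (mod int q)" using nonresidue_ex[OF q2] by blast
  interpret quad_field q d
    by (intro quad_field.intro ideal_congruence_quad quad_field_axioms.intro q(1) q2 d)
  interpret residue_field_sq "quad_ideal q d" "quad_reps q" q by (rule residue_field_sq)
  show ?thesis
  proof (rule gadget_exists[OF \<open>L < a\<close> q(2) _ \<open>B \<le> q\<close> _ _ S])
    show "0 < B" by (simp add: B_def)
    show "t \<le> 2 * a * q * q ^ L * B" using \<open>t \<le> X * B\<close> by (simp add: X_def A_def)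
    have "32 * a * q * q ^ L * B = 16 * (X * B)" by (simp add: X_def A_def)
    also have "\<dots> \<le> 32 * t" using \<open>X * B \<le> 2 * t\<close> by linarith
    finally have "q ^ (32 * a * q * q ^ L * B) \<le> q ^ (32 * t)" using q2 by (intro power_increasing) auto
    with D show "q ^ (32 * a * q * q ^ L * B) \<le> D" by simp
  qed
qed

section \<open>Supply of primes\<close>

lemma four_mult_power_less:
  fixes b b' :: nat
  assumes "2 * b + 11 \<le> b'"
  shows "4 * b * 2 ^ (b + 9) < 2 ^ b'"
proof -
  have "4 * b * 2 ^ (b + 9) < 4 * 2 ^ b * 2 ^ (b + 9)"
    using less_exp[of b] by (intro mult_strict_right_mono) auto
  also have "\<dots> = (2::nat) ^ (2 * b + 11)" unfolding power_add mult_2 by simp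
  also have "\<dots> \<le> 2 ^ b'" using assms by (intro power_increasing) auto
  finally show ?thesis .
qed

text \<open>By Chebyshev there are at least \<open>2 ^ (4 * b - 1) / (4 * b)\<close> primes up to
  \<open>2 ^ (4 * b)\<close>. This outweighs the \<open>O(2 ^ b)\<close> primes that are needed or
  too small.\<close>

lemma many_primes:
  fixes a b :: nat
  assumes "2 ^ b \<le> a" "a < 2 ^ Suc b" "7 \<le> b"
  shows "\<exists>p. inj_on p {..<12 * (a + 2) div b + 1} \<and>
    (\<forall>i<12 * (a + 2) div b + 1. prime (p i) \<and> 168 * a \<le> p i \<and> p i \<le> 2 ^ (4 * b))"
proof -
  define K where "K = 12 * (a + 2) div b + 1"
  define Pr where "Pr = {p::nat. prime p \<and> p \<le> 2 ^ (4 * b)}"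
  have fin: "finite Pr" unfolding Pr_def by (rule finite_subset[of _ "{..2 ^ (4 * b)}"]) auto
  obtain b' where b': "4 * b = Suc b'" using assms(3) by (cases "4 * b") auto
  have "(2::nat) ^ (2 ^ b') \<le> (2 ^ (4 * b)) ^ card Pr"
    using chebyshev_lower[of "2 ^ b'"] by (simp add: Pr_def b')
  then have "(2::nat) ^ (2 ^ b') \<le> 2 ^ (4 * b * card Pr)" by (simp only: power_mult)
  then have Pr: "2 ^ b' \<le> 4 * b * card Pr" by (simp only: power_increasing_iff one_less_numeral_iff semiring_norm)
  define R where "R = {p \<in> Pr. 168 * a \<le> p}"
  have "Pr \<subseteq> R \<union> {..<168 * a}" by (auto simp: R_def)
  then have "card Pr \<le> card (R \<union> {..<168 * a})" using fin by (intro card_mono) (auto simp: R_def)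
  also have "\<dots> \<le> card R + 168 * a" using card_Un_le[of R "{..<168 * a}"] by simp
  finally have R: "card Pr \<le> card R + 168 * a" .
  have "K \<le> card R"
  proof (rule ccontr)
    assume "\<not> K \<le> card R"
    then have "card Pr \<le> 12 * (a + 2) + 1 + 168 * a"
      using R div_le_dividend[of "12 * (a + 2)" b] unfolding K_def by linarith
    also have "\<dots> \<le> 256 * a"
    proof -
      have "2 ^ 7 \<le> (2::nat) ^ b" using assms(3) by (intro power_increasing) auto
      with assms(1) show ?thesis by simp
    qed
    also have "\<dots> \<le> 2 ^ (b + 9)" using assms(2) by (simp add: power_add)
    finally have "card Pr \<le> 2 ^ (b + 9)" .
    with Pr b' four_mult_power_less[of b b'] assms(3) mult_left_mono[of "card Pr" "2 ^ (b + 9)" "4 * b"]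
    show False by linarith
  qed
  then obtain R' where R': "R' \<subseteq> R" "card R' = K" "finite R'"
    using obtain_subset_with_card_n by metis
  obtain p where p: "bij_betw p {..<K} R'"
    using ex_bij_betw_nat_finite[OF R'(3)] R'(2) by (auto simp: lessThan_atLeast0)
  have "inj_on p {..<K}" using p by (simp add: bij_betw_def)
  moreover have "p i \<in> R" if "i < K" for i using p R'(1) that by (auto simp: bij_betw_def)
  ultimately show ?thesis unfolding K_def[symmetric] by (intro exI[of _ p]) (auto simp: R_def Pr_def)
qed

lemma prod_primes_dvd:
  fixes x :: nat
  assumes "finite S" "\<And>p. p \<in> S \<Longrightarrow> prime p \<and> p dvd x"
  shows "\<Prod>S dvd x"
  using assms
proof induction
  case (insert p S)
  have "coprime p (\<Prod>S)"
    using insert by (intro prod_coprime_right primes_coprime) auto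
  then show ?case using insert by (simp add: divides_mult)
qed simp

text \<open>The primes in question all divide the difference of \<open>v\<close> and
  \<open>v'\<close>. Their product is at least \<open>2 ^ b\<close> to their number, yet the
  difference is below \<open>2 ^ Suc a\<close>.\<close>

lemma few_prime_divisors:
  fixes p :: "nat \<Rightarrow> nat"
  assumes p: "inj_on p {..<K}" "\<And>i. i < K \<Longrightarrow> prime (p i) \<and> 2 ^ b \<le> p i"
    and v: "v < 2 ^ Suc a" "v' < 2 ^ Suc a" "v \<noteq> v'"
  shows "b * card {i \<in> {..<K}. [v = v'] (mod p i)} \<le> a"
proof -
  define x where "x = max v v' - min v v'"
  define S where "S = {i \<in> {..<K}. [v = v'] (mod p i)}"
  have x: "0 < x" "x < 2 ^ Suc a" using v by (auto simp: x_def max_def min_def)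
  have dvd: "p i dvd x" if "i \<in> S" for i
    using that cong_altdef_nat[of v v' "p i"] cong_altdef_nat[of v' v "p i"]
    by (auto simp: S_def x_def max_def min_def cong_sym_eq)
  have inj: "inj_on p S" using p(1) by (rule inj_on_subset) (auto simp: S_def)
  have "(2 ^ b) ^ card S = (\<Prod>i\<in>S. 2 ^ b)" by simp
  also have "\<dots> \<le> (\<Prod>i\<in>S. p i)" by (intro prod_mono) (use p(2) in \<open>auto simp: S_def\<close>)
  also have "\<dots> = \<Prod>(p ` S)" by (simp add: prod.reindex[OF inj])
  also have "\<dots> \<le> x"
    by (intro dvd_imp_le prod_primes_dvd x) (use p(2) dvd in \<open>auto simp: S_def\<close>)
  also note x(2)
  finally have "(2::nat) ^ (b * card S) < 2 ^ Suc a" by (simp only: power_mult)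
  then show ?thesis unfolding S_def[symmetric]
    using power_less_imp_less_exp[of "2::nat" "b * card S" "Suc a"] by simp
qed

section \<open>The protocol and its cost\<close>

text \<open>Primes up to \<open>2 ^ (4 * b)\<close> make a field element cost \<open>8 * b\<close>
  bits and a proof \<open>128 * b * t\<close> bits. The first \<open>Suc a\<close> bits of the
  advice are the claimed value.\<close>

lemma IP_protocol:
  fixes n a b t :: nat
  assumes a: "n < 2 ^ Suc a" and b: "2 ^ b \<le> a" "a < 2 ^ Suc b" "7 \<le> b"
    and t: "2 * a * 2 ^ (4 * b) \<le> t" "t \<le> n"
  shows "\<exists>P. ma_computes n P (IP n) \<and>
    ma_cost P = Suc a + (12 * (a + 2) div b + 1) * (128 * b * t) + (n div t + 1) * (8 * b)"
proof -
  define K where "K = 12 * (a + 2) div b + 1"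
  define J where "J = n div t + 1"
  obtain p where p: "inj_on p {..<K}"
    "\<And>i. i < K \<Longrightarrow> prime (p i) \<and> 168 * a \<le> p i \<and> p i \<le> 2 ^ (4 * b)"
    using many_primes[OF b] unfolding K_def by blast
  have a0: "0 < a" using b(1) by (metis gr0I le_zero_eq power_not_zero zero_neq_numeral)
  have "\<exists>N enc acc. gadget (p i) J t (2 ^ (128 * b * t)) (2 ^ (8 * b)) N enc acc" if i: "i < K" for i
  proof (rule prime_gadget[where a = a])
    show "2 * a * p i \<le> t" using p(2)[OF i] t(1) mult_left_mono[of "p i" "2 ^ (4 * b)" "2 * a"] by linarith
    show "t < 2 ^ Suc a" using t(2) a by linarith
    have "p i ^ (32 * t) \<le> (2 ^ (4 * b)) ^ (32 * t)" using p(2)[OF i] by (intro power_mono) auto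
    also have "\<dots> = 2 ^ (128 * b * t)" unfolding power_mult[symmetric] by (simp add: ac_simps)
    finally show "p i ^ (32 * t) \<le> 2 ^ (128 * b * t)" .
    have "p i * p i \<le> 2 ^ (4 * b) * 2 ^ (4 * b)" using p(2)[OF i] by (intro mult_mono) auto
    also have "\<dots> = 2 ^ (8 * b)" by (simp flip: power_add)
    finally show "p i * p i \<le> 2 ^ (8 * b)" .
  qed (use p(2)[OF i] a0 in auto)
  then obtain N enc acc where g: "\<And>i. i < K \<Longrightarrow>
      gadget (p i) J t (2 ^ (128 * b * t)) (2 ^ (8 * b)) (N i) (enc i) (acc i)"
    by metis
  have "\<exists>P. ma_computes n P (IP n) \<and> ma_cost P = Suc a + K * (128 * b * t) + J * (8 * b)"
  proof (rule protocol_from_gadgets[OF _ _ a g])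
    show "0 < K" by (simp add: K_def)
    have "0 < t" using t(1) a0 by (metis gr0I le_zero_eq mult_eq_0_iff power_not_zero zero_neq_numeral less_irrefl)
    then show "n \<le> J * t" unfolding J_def using dividend_less_div_times[of t n] by simp
    fix v v' :: nat
    assume v: "v < 2 ^ Suc a" "v' < 2 ^ Suc a" "v \<noteq> v'"
    have "b * card {i \<in> {..<K}. [v = v'] (mod p i)} \<le> a"
      by (rule few_prime_divisors[OF p(1) _ v]) (use p(2) b(1) in fastforce)
    \<comment> \<open>\<open>K\<close> is chosen with \<open>12 * a < b * K\<close>, so a wrong
      value survives at most \<open>K / 12\<close> of the primes.\<close>
    then have "b * (12 * card {i \<in> {..<K}. [v = v'] (mod p i)}) \<le> 12 * (a + 2)" by simp
    also have "\<dots> < b * K" using dividend_less_times_div[of b "12 * (a + 2)"] b(3) by (simp add: K_def)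
    finally show "12 * card {i \<in> {..<K}. [v = v'] (mod p i)} \<le> K" by simp
  qed
  then show ?thesis by (simp only: K_def J_def)
qed

text \<open>The last two hypotheses place \<open>t\<close> within 1 of the square root of
  \<open>n * b / a\<close>, where the costs \<open>a * t\<close> for the proofs and
  \<open>b * n / t\<close> for the message balance.\<close>

lemma cost_bound:
  fixes n a b t :: nat
  assumes "1 \<le> b" "b \<le> a" "1 < t" "n * b \<le> t ^ 2 * a" "(t - 1) ^ 2 * a < n * b"
  shows "real (Suc a + (12 * (a + 2) div b + 1) * (128 * b * t) + (n div t + 1) * (8 * b))
    \<le> 9600 * sqrt (real n * real a * real b)"
proof -
  have a1: "1 \<le> a" using assms by simp
  have "b * (12 * (a + 2) div b + 1) \<le> 12 * (a + 2) + b" using times_div_less_eq_dividend[of b "12 * (a + 2)"] by simp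
  also have "\<dots> \<le> 37 * a" using assms a1 by simp
  finally have "128 * t * (b * (12 * (a + 2) div b + 1)) \<le> 128 * t * (37 * a)" by (rule mult_left_mono) simp
  then have 1: "(12 * (a + 2) div b + 1) * (128 * b * t) \<le> 4736 * (a * t)" by (simp only: ac_simps)
  have "t * (n div t * b) \<le> n * b"
    unfolding mult.assoc[symmetric] by (intro mult_right_mono times_div_less_eq_dividend) simp
  also have "\<dots> \<le> t * (t * a)" using assms(4) by (simp add: power2_eq_square)
  finally have 2: "n div t * b \<le> a * t" using assms(3) by (simp add: mult.commute)
  have 3: "a \<le> a * t" using assms(3) by simp
  have "(n div t + 1) * (8 * b) = 8 * (n div t * b) + 8 * b" by (simp add: algebra_simps)
  with 1 2 3 assms(2) a1
  have "Suc a + (12 * (a + 2) div b + 1) * (128 * b * t) + (n div t + 1) * (8 * b) \<le> 4800 * (a * t)"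
    by linarith
  \<comment> \<open>The upper bound on \<open>n * b\<close> below is in terms of \<open>t\<close>,
    the lower one in terms of \<open>t - 1\<close>; they differ by a factor of at most 2 since
    \<open>t \<ge> 2\<close>.\<close>
  also have "\<dots> \<le> 9600 * (a * (t - 1))"
  proof -
    obtain s where "t = Suc (Suc s)" using assms(3) less_iff_Suc_add[of 1 t] by auto
    then show ?thesis by (simp add: algebra_simps)
  qed
  finally have 4: "real (Suc a + (12 * (a + 2) div b + 1) * (128 * b * t) + (n div t + 1) * (8 * b)) \<le> 9600 * real (a * (t - 1))"
    by (metis of_nat_le_iff of_nat_mult of_nat_numeral)
  have "(a * (t - 1)) ^ 2 = a * ((t - 1) ^ 2 * a)" by (simp add: power2_eq_square)
  also have "\<dots> \<le> a * (n * b)" using assms(5) by (intro mult_left_mono) auto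
  finally have "real ((a * (t - 1)) ^ 2) \<le> real (a * (n * b))" by (simp only: of_nat_le_iff)
  then have "real (a * (t - 1)) ^ 2 \<le> real n * real a * real b" by (simp add: ac_simps)
  then have "real (a * (t - 1)) \<le> sqrt (real n * real a * real b)" by (rule real_le_rsqrt)
  with 4 show ?thesis by linarith
qed

text \<open>\<open>a\<close> and \<open>b\<close> are the binary logarithms of \<open>n\<close> and
  \<open>a\<close> rounded down; the threshold on \<open>n\<close> ensures
  \<open>b \<ge> 7\<close>.\<close>

lemma IP_protocol_large:
  assumes "2 ^ 128 \<le> n"
  shows "\<exists>P. ma_computes n P (IP n) \<and>
    real (ma_cost P) \<le> 9600 * sqrt (real n * log 2 (real n) * log 2 (log 2 (real n)))"
proof -
  have "0 < n" using assms by (metis gr0I le_zero_eq power_not_zero zero_neq_numeral)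
  then obtain a where a: "2 ^ a \<le> n" "n < 2 ^ Suc a" using ex_power_ivl1[of 2 n] by auto
  have "(2::nat) ^ 128 < 2 ^ Suc a" using assms a(2) by (rule le_less_trans)
  then have a128: "128 \<le> a" using power_less_imp_less_exp[of "2::nat" 128 "Suc a"] by simp
  then obtain b where b: "2 ^ b \<le> a" "a < 2 ^ Suc b" using ex_power_ivl1[of 2 a] by auto
  have "(2::nat) ^ 7 < 2 ^ Suc b" using a128 b(2) by simp
  then have b7: "7 \<le> b" using power_less_imp_less_exp[of "2::nat" 7 "Suc b"] by simp
  have ba: "b \<le> a" using less_exp[of b] b(1) by linarith
  define t where "t = (LEAST t. n * b \<le> t ^ 2 * a)"
  have ex: "n * b \<le> n ^ 2 * a"
    unfolding power2_eq_square using ba \<open>0 < n\<close> by (intro mult_mono) auto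
  have t1: "n * b \<le> t ^ 2 * a" unfolding t_def by (rule LeastI[of _ n]) (rule ex)
  have tn: "t \<le> n" unfolding t_def by (rule Least_le) (rule ex)
  \<comment> \<open>Otherwise \<open>t\<close> would be at most \<open>2 ^ (5 * b + 2)\<close>, and
    \<open>n \<le> t ^ 2 * a\<close> would make \<open>n\<close> polylogarithmic in itself:
    \<open>a \<le> 11 * b + 5 < 2 ^ b\<close>.\<close>
  have large: "2 * a * 2 ^ (4 * b) \<le> t"
  proof (rule ccontr)
    assume "\<not> ?thesis"
    then have "t \<le> 2 ^ (5 * b + 2)"
    proof -
      assume "\<not> 2 * a * 2 ^ (4 * b) \<le> t"
      then have "t \<le> 2 * a * 2 ^ (4 * b)" by simp
      also have "\<dots> \<le> 2 * 2 ^ Suc b * 2 ^ (4 * b)" using b(2) by simp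
      also have "\<dots> = 2 ^ (5 * b + 2)" by (simp add: power_add[symmetric])
      finally show ?thesis .
    qed
    have "n * 1 \<le> n * b" using b7 by (intro mult_left_mono) auto
    also note t1
    also have "t ^ 2 * a \<le> (2 ^ (5 * b + 2)) ^ 2 * 2 ^ Suc b"
      by (intro mult_mono power_mono) (use b(2) \<open>t \<le> 2 ^ (5 * b + 2)\<close> in auto)
    also have "\<dots> = 2 ^ (11 * b + 5)"
      unfolding power_mult[symmetric] power_add[symmetric] by (rule arg_cong[where f = "power 2"]) simp
    finally have "(2::nat) ^ a \<le> 2 ^ (11 * b + 5)" using a(1) by linarith
    then have "a \<le> 11 * b + 5" by (rule power_le_imp_le_exp[rotated]) simp
    moreover have "11 * b + 5 < 2 ^ b" using b7 by (induction b rule: dec_induct) auto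
    ultimately show False using b(1) by simp
  qed
  have "1 \<le> a" using a128 by simp
  then have "2 * 1 * 1 \<le> 2 * a * 2 ^ (4 * b)" by (intro mult_mono) auto
  then have "1 < t" using large by linarith
  have "(t - 1) ^ 2 * a < n * b"
    using not_less_Least[of "t - 1" "\<lambda>t. n * b \<le> t ^ 2 * a"] \<open>1 < t\<close> unfolding t_def[symmetric] by simp
  note cost = cost_bound[OF _ ba \<open>1 < t\<close> t1 this]
  obtain P where P: "ma_computes n P (IP n)"
    "ma_cost P = Suc a + (12 * (a + 2) div b + 1) * (128 * b * t) + (n div t + 1) * (8 * b)"
    using IP_protocol[OF a(2) b b7 large tn] by blast
  have la: "real a \<le> log 2 (real n)"
    using le_log_of_power[of 2 a "real n"] a(1) by (simp flip: of_nat_power add: of_nat_le_iff)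
  have "real b \<le> log 2 (real a)"
    using le_log_of_power[of 2 b "real a"] b(1) by (simp flip: of_nat_power add: of_nat_le_iff)
  also have "\<dots> \<le> log 2 (log 2 (real n))" using la \<open>1 \<le> a\<close> by simp
  finally have lb: "real b \<le> log 2 (log 2 (real n))" .
  have "real (ma_cost P) \<le> 9600 * sqrt (real n * real a * real b)"
    unfolding P(2) by (rule cost) (use b7 in simp)
  also have "\<dots> \<le> 9600 * sqrt (real n * log 2 (real n) * log 2 (log 2 (real n)))"
    using la lb by (intro mult_left_mono real_sqrt_le_mono mult_mono) auto
  finally show ?thesis using P(1) by blast
qed

text \<open>Bob sends his whole input as a single symbol and the proof is empty. Modulus 0 turns
  congruence into equality.\<close>

lemma IP_protocol_trivial: "\<exists>P. ma_computes n P (IP n)"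
proof -
  define enc :: "(nat \<Rightarrow> bool) \<Rightarrow> nat \<Rightarrow> nat" where "enc y r = bits_val (map y [0..<n])" for y r
  define acc :: "(nat \<Rightarrow> nat \<Rightarrow> bool) \<Rightarrow> nat \<Rightarrow> nat \<Rightarrow> nat \<Rightarrow> nat list \<Rightarrow> bool"
    where "acc X v w r m \<longleftrightarrow> v = bool_inner 1 n X (\<lambda>_. bit (m ! 0))" for X v w r m
  have acc: "acc X v w r (map (\<lambda>j. enc (Y j) r) [0..<1]) \<longleftrightarrow> v = bool_inner 1 n X Y" for X Y v w r
    by (simp add: acc_def bool_inner_def enc_def bit_horner_sum_bit_iff)
  have "enc y r < 2 ^ n" for y r
    using bits_val_less[of "map y [0..<n]"] by (simp add: enc_def)
  then have g: "gadget 0 1 n (2 ^ 0) (2 ^ n) 1 enc acc"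
    unfolding gadget_def acc by auto
  have "\<exists>P. ma_computes n P (IP n) \<and> ma_cost P = n + 1 * 0 + 1 * n"
    by (rule protocol_from_gadgets[where p = "\<lambda>_. 0", OF _ _ _ g]) auto
  then show ?thesis by blast
qed

theorem theorem1p24:
  "(\<exists>P :: nat \<Rightarrow> ma_protocol.
      (\<forall>n. ma_decides n (P n) (DISJ n)) \<and>
      (\<lambda>n. real (ma_cost (P n)))
        \<in> O(\<lambda>n. sqrt (real n * log 2 (real n) * log 2 (log 2 (real n))))) \<and>
   (\<exists>P :: nat \<Rightarrow> ma_protocol.
      (\<forall>n. ma_computes n (P n) (IP n)) \<and>
      (\<lambda>n. real (ma_cost (P n)))
        \<in> O(\<lambda>n. sqrt (real n * log 2 (real n) * log 2 (log 2 (real n)))))"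
proof -
  let ?g = "\<lambda>n::nat. sqrt (real n * log 2 (real n) * log 2 (log 2 (real n)))"
  \<comment> \<open>The finitely many small \<open>n\<close> only need some protocol, as the
    asymptotic bound ignores their cost.\<close>
  have "\<exists>P. ma_computes n P (IP n) \<and> (2 ^ 128 \<le> n \<longrightarrow> real (ma_cost P) \<le> 9600 * ?g n)" for n
    using IP_protocol_large IP_protocol_trivial by (cases "2 ^ 128 \<le> n") blast+
  then obtain P where P: "\<And>n. ma_computes n (P n) (IP n)"
    "\<And>n. 2 ^ 128 \<le> n \<Longrightarrow> real (ma_cost (P n)) \<le> 9600 * ?g n" by metis
  have "\<exists>P'. ma_decides n P' (DISJ n) \<and> ma_cost P' = ma_cost (P n)" for n
    using decides_from_computes[OF P(1)[of n]] unfolding DISJ_def[abs_def] .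
  then obtain P' where P': "\<And>n. ma_decides n (P' n) (DISJ n)" "\<And>n. ma_cost (P' n) = ma_cost (P n)" by metis
  have O: "(\<lambda>n. real (ma_cost (P n))) \<in> O(?g)"
  proof (rule bigoI[of _ 9600])
    show "\<forall>\<^sub>F n in sequentially. norm (real (ma_cost (P n))) \<le> 9600 * norm (?g n)"
      using eventually_ge_at_top[of "2 ^ 128"]
    proof eventually_elim
      case (elim n)
      have "9600 * ?g n \<le> 9600 * norm (?g n)" by simp
      with P(2)[OF elim] show ?case by simp
    qed
  qed
  show ?thesis
    by (intro conjI exI[of _ P] exI[of _ P']) (use P P' O in auto)
qed

end
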